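(* The map ${}'\epsilon:\mathcal{X}_{N-2}\to E_N$ is a bijection.
   Context: Fix $N\in\{3,5,7,\dots\}$ and let $F=\mathbb{Z}/2\mathbb{Z}$. For $i\le j$ in $\mathbb{Z}$ let $[i,j]=\{h\in\mathbb{Z};i\le h\le j\}$, and let $S_N=[1,N]$. The set of all subsets of $S_N$ is an $F$-vector space with sum $X+X'=(X\cup X')-(X\cap X')$; let $E_N$ be the $F$-subspace of subsets of even cardinality, and ${}^2E_N$ the set of $2$-element subsets. A subset $\{i,j\}\in{}^2E_N$ is written $ij$ if either $i<j$ and $j-i$ is odd, or $i>j$ and $i-j$ is even. Let $\mathcal{P}_N$ be the set of unordered collections $B=\{X_1,\dots,X_k\}$ ($k\ge0$) of elements of ${}^2E_N$ that are pairwise disjoint; let $\mathrm{supp}(B)=\bigcup_{\{i,j\}\in B}\{i,j\}$, $B^0=\{\{i,j\}\in B; i-j \text{ even}\}$, $B^1=\{\{i,j\}\in B; i-j\text{ odd}\}$. A subset $X\subset S_N$ is $0$-covered (resp. $1$-covered) by $B^1$ if there exist $a_1b_1,\dots,a_sb_s\in B^1$ with $X=[a_1,b_1]\sqcup\dots\sqcup[a_s,b_s]$ (resp. $X=[a_1,b_1]\sqcup\dots\sqcup[a_s,b_s]\sqcup\{u\}$ for some $u$). Let ${}^*\mathcal{P}_N$ be the set of $B\in\mathcal{P}_N$ such that: for every $ij\in B^1$, $[i+1,j-1]$ is $0$-covered by $B^1$; and there is a (necessarily unique) sequence $(i_1,\dots,i_{2s})$ in $S_N$, $s=|B^0|$,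 with $B^0=\{i_{2s}i_1,i_{2s-1}i_2,\dots,i_{s+1}i_s\}$ such that, if $s\ge1$, each of $[i_1+1,i_2-1],\dots,[i_{s-1}+1,i_s-1],[i_{s+1}+1,i_{s+2}-1],\dots,[i_{2s-1}+1,i_{2s}-1]$ is $0$-covered by $B^1$. Let $\mathcal{X}_{N-2}^+$ be the set of $B\in{}^*\mathcal{P}_N$ such that $N\notin\mathrm{supp}(B)$ and either $s=0$, or $s$ is odd and one of: (i) $[1,i_1-1]$ is $1$-covered and $[i_{2s}+1,N-1]$ is $0$-covered by $B^1$; (ii) $[1,i_1-1]$ is $0$-covered and $[i_{2s}+1,N-1]$ is $1$-covered by $B^1$. Let $\mathcal{X}_{N-2}^-$ be the set of $B\in{}^*\mathcal{P}_N$ such that either $s=0$ or ($s\ge1$ and $[1,i_1-1]$, $[i_{2s}+1,N]$ are $0$-covered by $B^1$), and moreover $\{i,N\}\in B$ for some even $i$ if $s$ is even, for some odd $i$ if $s$ is odd. Let $\mathcal{X}_{N-2}=\mathcal{X}_{N-2}^+\sqcup\mathcal{X}_{N-2}^-$. For $B\in\mathcal{X}_{N-2}^+$ with $s$ odd, let $u_B$ be the unique $u\in[1,i_1-1]$ with $[1,u-1],[u+1,i_1-1]$ $0$-covered by $B^1$ in case (i) (then $u_B$ is odd), resp. the unique $u\in[i_{2s}+1,N-1]$ with $[i_{2s}+1,u-1],[u+1,N-1]$ $0$-covered by $B^1$ in case (ii) (then $u_B$ is even). For $ij\in{}^2E_N$ set $[[ij]]=[i,j]$ if $i<j$, $j-i$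 odd, and $[[ij]]=[i,N]\cup[1,j]$ if $i>j$, $i-j$ even. Define ${}'\epsilon(B)\in E_N$ (sums in $E_N$) by: ${}'\epsilon(B)=\sum_{ij\in B}[[ij]]$ if $B\in\mathcal{X}_{N-2}^-$ or ($B\in\mathcal{X}_{N-2}^+$, $|B^0|=0$); ${}'\epsilon(B)=\sum_{ij\in B}[[ij]]+[u_B,N]$ if $B\in\mathcal{X}_{N-2}^+$, $|B^0|$ odd, $u_B$ even; ${}'\epsilon(B)=\sum_{ij\in B}[[ij]]+[N,N]+[1,u_B]$ if $B\in\mathcal{X}_{N-2}^+$, $|B^0|$ odd, $u_B$ odd. *)

theory Defs
  imports Main
begin

text \<open>Elements of E_N and subsets of S_N are modelled as sets of naturals;
  the F-vector space sum is the symmetric difference.\<close>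

definition sdiff :: "nat set \<Rightarrow> nat set \<Rightarrow> nat set" where
  "sdiff X Y = (X - Y) \<union> (Y - X)"

text \<open>Sum over F = Z/2Z of a finite family: x lies in the sum iff it lies in an odd
  number of the summands.\<close>
definition symsum :: "('a \<Rightarrow> nat set) \<Rightarrow> 'a set \<Rightarrow> nat set" where
  "symsum f A = {x. odd (card {a \<in> A. x \<in> f a})}"

definition EN :: "nat \<Rightarrow> nat set set" where
  "EN N = {X. X \<subseteq> {1..N} \<and> even (card X)}"

definition PN :: "nat \<Rightarrow> nat set set set" where
  "PN N = {B. (\<forall>X\<in>B. X \<subseteq> {1..N} \<and> card X = 2) \<and>
               (\<forall>X\<in>B. \<forall>Y\<in>B. X \<noteq> Y \<longrightarrow> X \<inter> Y = {})}"

definition supp :: "nat set set \<Rightarrow> nat set" where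
  "supp B = \<Union>B"

definition B1 :: "nat set set \<Rightarrow> (nat \<times> nat) set" where
  "B1 B = {(a, b). {a, b} \<in> B \<and> a < b \<and> odd (b - a)}"

definition B0 :: "nat set set \<Rightarrow> (nat \<times> nat) set" where
  "B0 B = {(i, j). {i, j} \<in> B \<and> j < i \<and> even (i - j)}"

definition cov0 :: "nat set set \<Rightarrow> nat set \<Rightarrow> bool" where
  "cov0 B X \<longleftrightarrow> (\<exists>P \<subseteq> B1 B.
      (\<forall>p\<in>P. \<forall>q\<in>P. p \<noteq> q \<longrightarrow> {fst p..snd p} \<inter> {fst q..snd q} = {}) \<and>
      X = (\<Union>p\<in>P. {fst p..snd p}))"

definition cov1 :: "nat set set \<Rightarrow> nat set \<Rightarrow> bool" where
  "cov1 B X \<longleftrightarrow> (\<exists>P \<subseteq> B1 B. \<exists>u.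
      (\<forall>p\<in>P. \<forall>q\<in>P. p \<noteq> q \<longrightarrow> {fst p..snd p} \<inter> {fst q..snd q} = {}) \<and>
      u \<notin> (\<Union>p\<in>P. {fst p..snd p}) \<and>
      X = (\<Union>p\<in>P. {fst p..snd p}) \<union> {u})"

definition s0 :: "nat set set \<Rightarrow> nat" where
  "s0 B = card (B0 B)"

definition seq_ok :: "nat \<Rightarrow> nat set set \<Rightarrow> (nat \<Rightarrow> nat) \<Rightarrow> bool" where
  "seq_ok N B i \<longleftrightarrow> (let s = s0 B in
      strict_mono_on {1..2*s} i \<and> (\<forall>k\<in>{1..2*s}. i k \<in> {1..N}) \<and>
      B0 B = {(i (2*s + 1 - k), i k) | k. k \<in> {1..s}} \<and>
      (\<forall>k\<in>{1..s-1}. cov0 B {i k + 1 .. i (k+1) - 1}) \<and>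
      (\<forall>k\<in>{s+1..2*s-1}. cov0 B {i k + 1 .. i (k+1) - 1}))"

definition starPN :: "nat \<Rightarrow> nat set set set" where
  "starPN N = {B. B \<in> PN N \<and>
      (\<forall>(i, j)\<in>B1 B. cov0 B {i+1..j-1}) \<and> (\<exists>i. seq_ok N B i)}"

definition caseI :: "nat \<Rightarrow> nat set set \<Rightarrow> (nat \<Rightarrow> nat) \<Rightarrow> bool" where
  "caseI N B i \<longleftrightarrow> cov1 B {1..i 1 - 1} \<and> cov0 B {i (2 * s0 B) + 1..N-1}"

definition caseII :: "nat \<Rightarrow> nat set set \<Rightarrow> (nat \<Rightarrow> nat) \<Rightarrow> bool" where
  "caseII N B i \<longleftrightarrow> cov0 B {1..i 1 - 1} \<and> cov1 B {i (2 * s0 B) + 1..N-1}"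

definition Xplus :: "nat \<Rightarrow> nat set set set" where
  "Xplus N = {B. B \<in> starPN N \<and> N \<notin> supp B \<and>
      (s0 B = 0 \<or> (odd (s0 B) \<and> (\<exists>i. seq_ok N B i \<and> (caseI N B i \<or> caseII N B i))))}"

definition Xminus :: "nat \<Rightarrow> nat set set set" where
  "Xminus N = {B. B \<in> starPN N \<and>
      (s0 B = 0 \<or> (s0 B \<ge> 1 \<and> (\<exists>i. seq_ok N B i \<and> cov0 B {1..i 1 - 1} \<and>
                                        cov0 B {i (2 * s0 B) + 1..N}))) \<and>
      (if even (s0 B) then (\<exists>i. even i \<and> {i, N} \<in> B) else (\<exists>i. odd i \<and> {i, N} \<in> B))}"

definition XN :: "nat \<Rightarrow> nat set set set" where
  "XN N = Xplus N \<union> Xminus N"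

text \<open>u_B (for B in X^+ with s odd).\<close>
definition uB :: "nat \<Rightarrow> nat set set \<Rightarrow> nat" where
  "uB N B = (THE u. \<exists>i. seq_ok N B i \<and>
      ((caseI N B i \<and> u \<in> {1..i 1 - 1} \<and> cov0 B {1..u-1} \<and> cov0 B {u+1..i 1 - 1}) \<or>
       (caseII N B i \<and> u \<in> {i (2 * s0 B) + 1..N-1} \<and> cov0 B {i (2 * s0 B) + 1..u-1}
          \<and> cov0 B {u+1..N-1})))"

definition brk :: "nat \<Rightarrow> nat set \<Rightarrow> nat set" where
  "brk N X = (let a = Min X; b = Max X in
      if odd (b - a) then {a..b} else {b..N} \<union> {1..a})"

definition eps' :: "nat \<Rightarrow> nat set set \<Rightarrow> nat set" where
  "eps' N B = (let S = symsum (brk N) B in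
      if B \<in> Xminus N \<or> s0 B = 0 then S
      else if even (uB N B) then sdiff S {uB N B..N}
      else sdiff (sdiff S {N..N}) {1..uB N B})"

end

theory Submission
  imports Defs
begin

text \<open>
  Read an oriented pair \<open>ij\<close> as the cyclic interval running from \<open>i\<close> forward to \<open>j\<close>; the
  orientation convention says that this interval has even size. Let \<open>Y\<close> be the set of
  partial matchings in which every interior point of such an interval is matched inside that
  interior.

  The sum of the intervals is a bijection from \<open>Y\<close> to \<open>E\<^sub>N\<close>: let \<open>d p\<close> be the number of arcs above
  the gap between \<open>p\<close> and \<open>p + 1\<close>. Membership of \<open>p\<close> in the sum \<open>X\<close> determines \<open>d p\<close> from
  \<open>d (p - 1)\<close>, and \<open>d\<close> determines the matching by first return. Each of the two transitions is an
  involution of the naturals, conjugate to a reflection \<open>z \<mapsto> x - z\<close> of the integers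
  (\<open>x\<close> being 0 or 1). Since \<open>N\<close> is odd and \<open>X\<close> is even, their composite is a reflection in an
  integer, so exactly one starting depth closes up cyclically.

  Finally, for \<open>B\<close> with \<open>N\<close> unmatched and \<open>s\<close> odd, the correction term in the definition of
  the map is exactly the contribution of the extra arc joining \<open>u\<^sub>B\<close> to \<open>N\<close>. Adding this arc turns
  the domain into \<open>Y\<close>; it is undone by deleting the arc at \<open>N\<close> whenever the parities of its other
  end and of \<open>s\<close> disagree.
\<close>

subsection \<open>Cyclic arcs and depths\<close>

definition cyc :: "nat \<Rightarrow> nat \<Rightarrow> nat \<Rightarrow> nat set" where
  "cyc N i j = (if i < j then {i..j} else {i..N} \<union> {1..j})"

text \<open>A number p stands for the gap between the points p and p + 1. The numbers 0 and N name
  the same cyclic gap, so an arc that wraps around contains both.\<close>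

definition gap :: "nat \<Rightarrow> nat \<Rightarrow> nat \<Rightarrow> nat set" where
  "gap N i j = (if i < j then {i..<j} else {i..N} \<union> {..<j})"

text \<open>The pairs of B in the orientation \<open>ij\<close>. The parity of \<open>i + j\<close>
  replaces that of the difference, which avoids truncated subtraction.\<close>

definition arcs :: "nat set set \<Rightarrow> (nat \<times> nat) set" where
  "arcs B = {(i, j). {i, j} \<in> B \<and> i \<noteq> j \<and> (i < j \<longleftrightarrow> odd (i + j))}"

text \<open>This is the set called \<open>Y\<close> above. Besides forbidding crossings, the
  condition keeps unmatched points from lying under any arc.\<close>

definition noncr :: "nat \<Rightarrow> nat set set set" where
  "noncr N = {B \<in> PN N. \<forall>i j. (i, j) \<in> arcs B \<longrightarrow> (\<forall>q \<in> cyc N i j - {i, j}.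
     \<exists>k l. (k, l) \<in> arcs B \<and> q \<in> {k, l} \<and> cyc N k l \<subseteq> cyc N i j - {i, j})}"

definition depth :: "nat \<Rightarrow> nat set set \<Rightarrow> nat \<Rightarrow> nat" where
  "depth N B p = card {(i, j) \<in> arcs B. p \<in> gap N i j}"

lemma PN_finite:
  assumes "B \<in> PN N"
  shows "finite B"
proof (rule finite_subset)
  show "B \<subseteq> Pow {1..N}" using assms by (auto simp: PN_def)
qed simp

lemma PN_pair_eq:
  assumes "B \<in> PN N" "X \<in> B" "Y \<in> B" "x \<in> X" "x \<in> Y"
  shows "X = Y"
  using assms by (simp add: PN_def) blast

lemma PN_pairE:
  assumes "B \<in> PN N" "X \<in> B"
  obtains i j where "X = {i, j}" "(i, j) \<in> arcs B"
proof -
  have "card X = 2" using assms by (auto simp: PN_def)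
  then obtain a b where ab: "X = {a, b}" "a \<noteq> b" by (auto simp: card_2_iff)
  then consider "a < b" "odd (a + b)" | "b < a" "odd (a + b)" | "a < b" "even (a + b)" | "b < a" "even (a + b)"
    by linarith
  then show thesis
  proof cases
    case 1
    then show ?thesis using that[of a b] ab assms by (auto simp: arcs_def)
  next
    case 2
    then show ?thesis using that[of b a] ab assms by (auto simp: arcs_def insert_commute)
  next
    case 3
    then show ?thesis using that[of b a] ab assms by (auto simp: arcs_def insert_commute)
  next
    case 4
    then show ?thesis using that[of a b] ab assms by (auto simp: arcs_def)
  qed
qed

lemma arcs_range:
  assumes "B \<in> PN N" "(i, j) \<in> arcs B"
  shows "1 \<le> i" "i \<le> N" "1 \<le> j" "j \<le> N" "i \<noteq> j"
  using assms by (auto simp: PN_def arcs_def)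

lemma arcs_finite:
  assumes "B \<in> PN N"
  shows "finite (arcs B)"
proof (rule finite_subset)
  show "arcs B \<subseteq> {1..N} \<times> {1..N}" using arcs_range[OF assms] by auto
qed simp

lemma arcs_eq:
  assumes "B \<in> PN N" "(i, j) \<in> arcs B" "(k, l) \<in> arcs B" "{i, j} \<inter> {k, l} \<noteq> {}"
  shows "i = k \<and> j = l"
proof -
  have "{i, j} = {k, l}"
    using PN_pair_eq[OF assms(1), of "{i, j}" "{k, l}"] assms by (auto simp: arcs_def)
  then have "i = k \<and> j = l \<or> i = l \<and> j = k" by (auto simp: doubleton_eq_iff)
  then show ?thesis using assms(2,3) by (auto simp: arcs_def add.commute)
qed

lemma arcs_unique:
  assumes "B \<in> PN N" "(i, j) \<in> arcs B"
  shows "(i, k) \<in> arcs B \<Longrightarrow> k = j" "(k, j) \<in> arcs B \<Longrightarrow> k = i"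
    "(j, k) \<notin> arcs B" "(k, i) \<notin> arcs B"
  using arcs_eq[OF assms, of i k] arcs_eq[OF assms, of k j] arcs_eq[OF assms, of j k]
    arcs_eq[OF assms, of k i] arcs_range[OF assms] by auto

lemma PN_eq_arcs:
  assumes "B \<in> PN N"
  shows "B = (\<lambda>(i, j). {i, j}) ` arcs B"
proof (intro subset_antisym subsetI)
  fix X assume "X \<in> B"
  then show "X \<in> (\<lambda>(i, j). {i, j}) ` arcs B"
    by (elim PN_pairE[OF assms]) auto
qed (auto simp: arcs_def)

lemma brk_arc:
  assumes "(i, j) \<in> arcs B"
  shows "brk N {i, j} = cyc N i j"
  using assms by (auto simp: arcs_def brk_def cyc_def Let_def min_def max_def)

text \<open>Forgetting the orientation is a bijection from arcs to pairs, so the summands containing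
  x may be counted among the arcs.\<close>

lemma mem_symsum_brk:
  assumes "B \<in> PN N"
  shows "x \<in> symsum (brk N) B \<longleftrightarrow> odd (card {(i, j) \<in> arcs B. x \<in> cyc N i j})"
proof -
  have "bij_betw (\<lambda>(i, j). {i, j}) {(i, j) \<in> arcs B. x \<in> cyc N i j} {X \<in> B. x \<in> brk N X}"
    unfolding bij_betw_def
  proof
    show "inj_on (\<lambda>(i, j). {i, j}) {(i, j) \<in> arcs B. x \<in> cyc N i j}"
    proof (rule inj_onI, clarify)
      fix i j k l assume "(i, j) \<in> arcs B" "(k, l) \<in> arcs B" "{i, j} = {k, l}"
      then show "i = k \<and> j = l" using arcs_eq[OF assms, of i j k l] by auto
    qed
    show "(\<lambda>(i, j). {i, j}) ` {(i, j) \<in> arcs B. x \<in> cyc N i j} = {X \<in> B. x \<in> brk N X}"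
    proof (intro subset_antisym subsetI)
      fix X assume "X \<in> {X \<in> B. x \<in> brk N X}"
      then have X: "X \<in> B" "x \<in> brk N X" by auto
      then obtain i j where "X = {i, j}" "(i, j) \<in> arcs B" by (elim PN_pairE[OF assms])
      then show "X \<in> (\<lambda>(i, j). {i, j}) ` {(i, j) \<in> arcs B. x \<in> cyc N i j}"
        using X brk_arc by auto
    next
      fix X assume "X \<in> (\<lambda>(i, j). {i, j}) ` {(i, j) \<in> arcs B. x \<in> cyc N i j}"
      then obtain i j where "X = {i, j}" "(i, j) \<in> arcs B" "x \<in> cyc N i j" by auto
      then show "X \<in> {X \<in> B. x \<in> brk N X}" using brk_arc[of i j] by (auto simp: arcs_def)
    qed
  qed
  then show ?thesis by (auto simp: symsum_def dest: bij_betw_same_card)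
qed

lemma PN_symsum_brk_subset:
  assumes "B \<in> PN N"
  shows "symsum (brk N) B \<subseteq> {1..N}"
proof
  fix x assume "x \<in> symsum (brk N) B"
  then have "{(i, j) \<in> arcs B. x \<in> cyc N i j} \<noteq> {}"
    using mem_symsum_brk[OF assms, of x] by (metis card.empty even_zero)
  then obtain i j where "(i, j) \<in> arcs B" "x \<in> cyc N i j" by auto
  then show "x \<in> {1..N}"
    using arcs_range[OF assms, of i j] by (auto simp: cyc_def split: if_splits)
qed

text \<open>Compares the arcs above a point with those above its two neighbouring gaps. This links
  the sum, counted at points, with the depth, counted at gaps.\<close>

lemma gap_pred_iff:
  assumes "1 \<le> p" "p \<le> N" "1 \<le> i" "i \<le> N" "1 \<le> j" "j \<le> N" "i \<noteq> j"
  shows "p \<in> gap N i j \<longleftrightarrow> p \<in> cyc N i j \<and> j \<noteq> p"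
    and "p - 1 \<in> gap N i j \<longleftrightarrow> p \<in> cyc N i j \<and> i \<noteq> p"
  using assms by (auto simp: gap_def cyc_def)

text \<open>As no arc ends at p, the arcs above p are exactly those above gap p. All of them except
  the arc starting at p are also above gap p - 1.\<close>

lemma depth_open:
  assumes B: "B \<in> PN N" and ij: "(p, l) \<in> arcs B"
  shows "depth N B p = Suc (depth N B (p - 1))"
    and "p \<in> symsum (brk N) B \<longleftrightarrow> odd (depth N B p)"
proof -
  let ?C = "{(i, j) \<in> arcs B. p \<in> cyc N i j}"
  note r = arcs_range[OF B]
  have p: "1 \<le> p" "p \<le> N" using r[OF ij] by auto
  note g = gap_pred_iff[OF p r(1-5)]
  have ne: "j \<noteq> p" if "(i, j) \<in> arcs B" for i j
    using arcs_unique(4)[OF B ij] that by auto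
  have "{(i, j) \<in> arcs B. p \<in> gap N i j} = ?C" using g(1) ne by auto
  then have d: "depth N B p = card ?C" by (simp add: depth_def)
  have "{(i, j) \<in> arcs B. p - 1 \<in> gap N i j} = ?C - {(p, l)}"
    using g(2) arcs_unique(1)[OF B ij] by fast
  then have "depth N B (p - 1) = card (?C - {(p, l)})" by (simp add: depth_def)
  moreover have "(p, l) \<in> ?C" using ij p by (auto simp: cyc_def)
  moreover have "finite ?C" using arcs_finite[OF B] by (rule rev_finite_subset) auto
  ultimately show "depth N B p = Suc (depth N B (p - 1))"
    using d card.remove[of ?C "(p, l)"] by presburger
  show "p \<in> symsum (brk N) B \<longleftrightarrow> odd (depth N B p)"
    using d mem_symsum_brk[OF B] by simp
qed

lemma depth_close:
  assumes B: "B \<in> PN N" and ij: "(k, p) \<in> arcs B"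
  shows "depth N B (p - 1) = Suc (depth N B p)"
    and "p \<in> symsum (brk N) B \<longleftrightarrow> odd (depth N B (p - 1))"
proof -
  let ?C = "{(i, j) \<in> arcs B. p \<in> cyc N i j}"
  note r = arcs_range[OF B]
  have p: "1 \<le> p" "p \<le> N" using r[OF ij] by auto
  note g = gap_pred_iff[OF p r(1-5)]
  have ne: "i \<noteq> p" if "(i, j) \<in> arcs B" for i j
    using arcs_unique(3)[OF B ij] that by auto
  have "{(i, j) \<in> arcs B. p - 1 \<in> gap N i j} = ?C" using g(2) ne by auto
  then have d: "depth N B (p - 1) = card ?C" by (simp add: depth_def)
  have "{(i, j) \<in> arcs B. p \<in> gap N i j} = ?C - {(k, p)}"
    using g(1) arcs_unique(2)[OF B ij] by fast
  then have "depth N B p = card (?C - {(k, p)})" by (simp add: depth_def)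
  moreover have "(k, p) \<in> ?C" using ij p by (auto simp: cyc_def)
  moreover have "finite ?C" using arcs_finite[OF B] by (rule rev_finite_subset) auto
  ultimately show "depth N B (p - 1) = Suc (depth N B p)"
    using d card.remove[of ?C "(k, p)"] by presburger
  show "p \<in> symsum (brk N) B \<longleftrightarrow> odd (depth N B (p - 1))"
    using d mem_symsum_brk[OF B] by simp
qed

text \<open>In a member of \<open>noncr\<close> an unmatched point lies under no arc, and an arc
  above an adjacent gap would also be above the point.\<close>

lemma depth_single:
  assumes B: "B \<in> noncr N" and p: "1 \<le> p" "p \<le> N" "p \<notin> supp B"
  shows "depth N B (p - 1) = 0" "depth N B p = 0" "p \<notin> symsum (brk N) B"
proof -
  have BP: "B \<in> PN N" using B by (simp add: noncr_def)
  have ns: "p \<notin> {i, j}" if "(i, j) \<in> arcs B" for i j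
    using p that by (auto simp: supp_def arcs_def)
  have *: "p \<notin> cyc N i j" if "(i, j) \<in> arcs B" for i j
    using B ns that unfolding noncr_def by blast
  have "p - 1 \<notin> gap N i j \<and> p \<notin> gap N i j" if "(i, j) \<in> arcs B" for i j
    using *[OF that] gap_pred_iff[OF p(1,2) arcs_range[OF BP that]] by blast
  then show "depth N B (p - 1) = 0" "depth N B p = 0"
    by (auto simp: depth_def card_eq_0_iff)
  have "{(i, j) \<in> arcs B. p \<in> cyc N i j} = {}" using * by auto
  then show "p \<notin> symsum (brk N) B"
    unfolding mem_symsum_brk[OF BP] by (metis card.empty even_zero)
qed

lemma point_cases:
  assumes "B \<in> PN N"
  obtains (start) l where "(p, l) \<in> arcs B" | (finish) k where "(k, p) \<in> arcs B" | (free) "p \<notin> supp B"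
proof (cases "p \<in> supp B")
  case True
  then obtain X where "X \<in> B" "p \<in> X" by (auto simp: supp_def)
  then show ?thesis using PN_pairE[OF assms, of X] start finish by (metis insertE singletonD)
qed (use free in blast)

text \<open>
  The subtraction is truncated on purpose: an unmatched point, which leaves the depth at 0, is the
  case \<open>d = 0\<close> with \<open>x\<close> false.
\<close>
definition step :: "bool \<Rightarrow> nat \<Rightarrow> nat" where
  "step x d = (if x = odd d then d - 1 else Suc d)"

lemma step_inj: "step x d = step y d \<Longrightarrow> x = y"
  by (auto simp: step_def split: if_splits)

lemma step_cases:
  "step x d = Suc d \<or> d = Suc (step x d) \<or> (d = 0 \<and> step x d = 0)"
  by (auto simp: step_def)

text \<open>The number of arcs above p is the larger of the two adjacent depths. So the parity read
  off from the sum agrees with that of the previous depth when an arc ends at p or p is unmatched,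
  and differs when an arc starts at p.\<close>

lemma depth_step:
  assumes B: "B \<in> noncr N" and p: "1 \<le> p" "p \<le> N"
  shows "depth N B p = step (p \<in> symsum (brk N) B) (depth N B (p - 1))"
proof -
  have BP: "B \<in> PN N" using B by (simp add: noncr_def)
  show ?thesis
  proof (rule point_cases[OF BP, of p])
    fix l assume "(p, l) \<in> arcs B"
    from depth_open[OF BP this] show ?thesis by (auto simp: step_def)
  next
    fix k assume "(k, p) \<in> arcs B"
    from depth_close[OF BP this] show ?thesis by (auto simp: step_def)
  next
    assume "p \<notin> supp B"
    from depth_single[OF B p this] show ?thesis by (auto simp: step_def)
  qed
qed

lemma depth_0_eq_N:
  assumes B: "B \<in> PN N"
  shows "depth N B 0 = depth N B N"
proof -
  have "0 \<in> gap N i j \<longleftrightarrow> N \<in> gap N i j" if "(i, j) \<in> arcs B" for i j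
    using arcs_range[OF B that] by (auto simp: gap_def)
  then have "{(i, j) \<in> arcs B. 0 \<in> gap N i j} = {(i, j) \<in> arcs B. N \<in> gap N i j}" by blast
  then show ?thesis by (simp add: depth_def)
qed

section \<open>The walk of depths determined by a subset\<close>

text \<open>The depths forced by X once a depth s is chosen for gap 0. The right s is a fixed point
  of going once around the circle.\<close>

fun walk :: "nat set \<Rightarrow> nat \<Rightarrow> nat \<Rightarrow> nat" where
  "walk X s 0 = s"
| "walk X s (Suc p) = step (Suc p \<in> X) (walk X s p)"

lemma depth_walk:
  assumes B: "B \<in> noncr N" and "p \<le> N"
  shows "depth N B p = walk (symsum (brk N) B) (depth N B 0) p"
  using assms(2)
proof (induction p)
  case (Suc p)
  then show ?case using depth_step[OF B, of "Suc p"] by simp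
qed simp

text \<open>
  Lists the integers as 0, 1, -1, 2, -2, ..., which makes both transitions reflections.
\<close>
definition zeta :: "nat \<Rightarrow> int" where
  "zeta d = (if even d then - int (d div 2) else int (d div 2) + 1)"

lemma zeta_inj: "zeta d = zeta e \<Longrightarrow> d = e"
  by (auto simp: zeta_def elim!: evenE oddE split: if_splits)

lemma zeta_surj: "\<exists>d. zeta d = z"
proof (cases "z \<le> 0")
  case True
  then have "zeta (2 * nat (- z)) = z" by (simp add: zeta_def)
  then show ?thesis ..
next
  case False
  then have "zeta (2 * nat (z - 1) + 1) = z" by (simp add: zeta_def)
  then show ?thesis ..
qed

text \<open>With x false, \<open>step\<close> fixes 0 and swaps 1 with 2, 3 with 4 and so on, as z
  to -z does on the listed integers. With x true it swaps 0 with 1, 2 with 3 and so on, as z to 1 -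
  z does.\<close>

lemma zeta_step: "zeta (step x d) = of_bool x - zeta d"
  by (cases x; auto simp: zeta_def step_def elim!: evenE oddE)

text \<open>The image of 0 under the composite of the first p reflections, an alternating sum of the
  indicator of X.\<close>

fun offset :: "nat set \<Rightarrow> nat \<Rightarrow> int" where
  "offset X 0 = 0"
| "offset X (Suc p) = of_bool (Suc p \<in> X) - offset X p"

lemma zeta_walk: "zeta (walk X s p) = offset X p + (-1) ^ p * zeta s"
  by (induction p) (auto simp: zeta_step)

text \<open>Signs do not matter modulo 2, so the alternating sum has the parity of the plain
  count.\<close>

lemma even_offset: "even (offset X p) \<longleftrightarrow> even (card (X \<inter> {1..p}))"
proof (induction p)
  case (Suc p)
  have "X \<inter> {1..Suc p} = (if Suc p \<in> X then insert (Suc p) (X \<inter> {1..p}) else X \<inter> {1..p})"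
    by (auto simp: le_Suc_eq)
  then show ?case using Suc by auto
qed simp

text \<open>For odd N the composite of N reflections sends z to \<open>offset X N - z\<close>, so a
  fixed point must be half the offset.\<close>

lemma walk_fixpoint_iff:
  assumes "odd N"
  shows "walk X s N = s \<longleftrightarrow> offset X N = 2 * zeta s"
proof -
  have "walk X s N = s \<longleftrightarrow> zeta (walk X s N) = zeta s" using zeta_inj by auto
  then show ?thesis using assms by (auto simp: zeta_walk)
qed

section \<open>Recovering the arcs from the depths by first return\<close>

text \<open>First return on the cycle, stated so that the partner can be sought from either
  end.\<close>

definition matched :: "nat \<Rightarrow> (nat \<Rightarrow> nat) \<Rightarrow> nat \<Rightarrow> nat \<Rightarrow> bool" where
  "matched N d i j \<longleftrightarrow> i \<in> {1..N} \<and> j \<in> {1..N} \<and> i \<noteq> j \<and> d i = Suc (d (i - 1)) \<and>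
     d (j - 1) = Suc (d j) \<and> d j = d (i - 1) \<and> (\<forall>p \<in> gap N i j. d i \<le> d p)"

lemma matchedD:
  assumes "matched N d i j"
  shows "1 \<le> i" "i \<le> N" "1 \<le> j" "j \<le> N" "i \<noteq> j"
    and "d i = Suc (d (i - 1))" "d (j - 1) = Suc (d j)" "d j = d (i - 1)"
    and "\<And>p. p \<in> gap N i j \<Longrightarrow> d i \<le> d p"
  using assms unfolding matched_def atLeastAtMost_iff by blast+

text \<open>Of two arcs with the same start, the shorter one ends at a gap inside the longer one,
  where the walk has already dropped too low.\<close>

lemma matched_unique_right:
  assumes "matched N d i j" "matched N d i k"
  shows "j = k"
proof (rule ccontr)
  note a = matchedD[OF assms(1)] and b = matchedD[OF assms(2)]
  assume "j \<noteq> k"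
  then have "j \<in> gap N i k \<or> k \<in> gap N i j"
    using a(1-5) b(1-5) by (auto simp: gap_def)
  then have "d i \<le> d j \<or> d i \<le> d k" using a(9) b(9) by auto
  then show False using a(6,8) b(8) by linarith
qed

text \<open>The mirror argument: the gap in front of the start of the shorter arc lies inside the
  longer one and is too low.\<close>

lemma matched_unique_left:
  assumes "matched N d j i" "matched N d k i"
  shows "j = k"
proof (rule ccontr)
  note a = matchedD[OF assms(1)] and b = matchedD[OF assms(2)]
  assume "j \<noteq> k"
  then have "j - 1 \<in> gap N k i \<or> k - 1 \<in> gap N j i"
    using a(1-5) b(1-5) by (auto simp: gap_def)
  then have "d k \<le> d (j - 1) \<or> d j \<le> d (k - 1)" using a(9) b(9) by auto
  then show False using a(6,8) b(6,8) by linarith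
qed

text \<open>\<open>noncr\<close> only provides some arc at q inside the interior; disjointness of
  the pairs makes it the given one.\<close>

lemma noncr_interior:
  assumes B: "B \<in> noncr N" and ij: "(i, j) \<in> arcs B" and kl: "(k, l) \<in> arcs B"
    and q: "q \<in> {k, l}" "q \<in> cyc N i j - {i, j}"
  shows "cyc N k l \<subseteq> cyc N i j - {i, j}"
proof -
  have BP: "B \<in> PN N" using B by (simp add: noncr_def)
  obtain k' l' where kl': "(k', l') \<in> arcs B" "q \<in> {k', l'}" "cyc N k' l' \<subseteq> cyc N i j - {i, j}"
    using B ij q(2) unfolding noncr_def by blast
  then have "k = k' \<and> l = l'" using arcs_eq[OF BP kl kl'(1)] q(1) by blast
  then show ?thesis using kl' by simp
qed

text \<open>The arcs above gap i are above every gap of the arc (i, j), and those above gap j - 1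
  are among them. So the depth inside never falls below its value at i, and has that value again
  just before j.\<close>

lemma arcs_matched:
  assumes B: "B \<in> noncr N" and ij: "(i, j) \<in> arcs B"
  shows "matched N (depth N B) i j"
proof -
  have BP: "B \<in> PN N" using B by (simp add: noncr_def)
  note r = arcs_range[OF BP]
  let ?g = "\<lambda>p. {(i, j) \<in> arcs B. p \<in> gap N i j}"
  have fin: "finite (?g p)" for p
    using arcs_finite[OF BP] by (rule rev_finite_subset) auto
  \<comment> \<open>An arc above gap i but not above gap p would end strictly inside (i, j), hence
    be nested there, although it contains i.\<close>
  have sub: "?g i \<subseteq> ?g p" if p: "p \<in> gap N i j" for p
  proof (rule subsetI, rule ccontr)
    fix a assume "a \<in> ?g i" and a2: "a \<notin> ?g p"
    then obtain k l where a: "a = (k, l)" "(k, l) \<in> arcs B" "i \<in> gap N k l" "p \<notin> gap N k l" by auto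
    then have "(k, l) \<noteq> (i, j)" using p by auto
    then have "l \<noteq> i" "l \<noteq> j" using arcs_eq[OF BP ij a(2)] by auto
    then have "l \<in> cyc N i j - {i, j}"
      using a p r[OF ij] r[OF a(2)] by (auto simp: gap_def cyc_def split: if_splits)
    then have "cyc N k l \<subseteq> cyc N i j - {i, j}" by (intro noncr_interior[OF B ij a(2), of l]) auto
    moreover have "i \<in> cyc N k l" using a(3) r[OF ij] by (auto simp: gap_def cyc_def split: if_splits)
    ultimately show False by auto
  qed
  \<comment> \<open>Symmetrically, an arc above the last gap but not above gap i would start
    strictly inside, although it contains j.\<close>
  have "?g (j - 1) \<subseteq> ?g i"
  proof (rule subsetI, rule ccontr)
    fix a assume "a \<in> ?g (j - 1)" and a2: "a \<notin> ?g i"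
    then obtain k l where a: "a = (k, l)" "(k, l) \<in> arcs B" "j - 1 \<in> gap N k l" "i \<notin> gap N k l" by auto
    have "i \<in> gap N i j" using r[OF ij] by (auto simp: gap_def)
    then have "(k, l) \<noteq> (i, j)" using a by auto
    then have "k \<noteq> i" "k \<noteq> j" using arcs_eq[OF BP ij a(2)] by auto
    then have "k \<in> cyc N i j - {i, j}"
      using a r[OF ij] r[OF a(2)] by (auto simp: gap_def cyc_def split: if_splits)
    then have "cyc N k l \<subseteq> cyc N i j - {i, j}" by (intro noncr_interior[OF B ij a(2), of k]) auto
    moreover have "j \<in> cyc N k l" using a(3) r[OF ij] r[OF a(2)] by (auto simp: gap_def cyc_def split: if_splits)
    ultimately show False by auto
  qed
  moreover have "j - 1 \<in> gap N i j" using r[OF ij] by (auto simp: gap_def)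
  ultimately have "?g (j - 1) = ?g i" using sub by blast
  then have "depth N B (j - 1) = depth N B i" by (simp add: depth_def)
  moreover have "depth N B i \<le> depth N B p" if "p \<in> gap N i j" for p
    unfolding depth_def by (rule card_mono[OF fin sub[OF that]])
  ultimately show ?thesis
    using r[OF ij] depth_open[OF BP ij] depth_close[OF BP ij] by (auto simp: matched_def)
qed

text \<open>Conversely, a rise of the depth at i can only come from an arc starting there, and its
  end is the unique first return.\<close>

lemma arcs_iff_matched:
  assumes B: "B \<in> noncr N"
  shows "(i, j) \<in> arcs B \<longleftrightarrow> matched N (depth N B) i j"
proof
  assume m: "matched N (depth N B) i j"
  have BP: "B \<in> PN N" using B by (simp add: noncr_def)
  show "(i, j) \<in> arcs B"
  proof (rule point_cases[OF BP, of i])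
    fix l assume "(i, l) \<in> arcs B"
    then show ?thesis using arcs_matched[OF B] matched_unique_right[OF m] by blast
  next
    fix k assume "(k, i) \<in> arcs B"
    from depth_close[OF BP this] m show ?thesis by (auto simp: matched_def)
  next
    assume "i \<notin> supp B"
    from depth_single[OF B _ _ this] m show ?thesis by (auto simp: matched_def)
  qed
qed (rule arcs_matched[OF B])

lemma matched_cong:
  assumes "\<And>p. p \<le> N \<Longrightarrow> d p = e p"
  shows "matched N d i j \<longleftrightarrow> matched N e i j"
proof -
  have "gap N i j \<subseteq> {..N}" if "j \<in> {1..N}" using that by (auto simp: gap_def)
  then show ?thesis using assms by (auto simp: matched_def subset_iff)
qed

text \<open>Gaps 0 and N coincide, so the depth at gap 0 is a fixed point of the walk around the
  circle.\<close>

lemma offset_noncr: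
  assumes N: "odd N" and B: "B \<in> noncr N"
  shows "offset (symsum (brk N) B) N = 2 * zeta (depth N B 0)"
proof -
  have "B \<in> PN N" using B by (auto simp: noncr_def)
  then have "walk (symsum (brk N) B) (depth N B 0) N = depth N B 0"
    using depth_walk[OF B, of N] depth_0_eq_N[of B N] by simp
  then show ?thesis by (simp only: walk_fixpoint_iff[OF N])
qed

text \<open>The sum determines the depth at gap 0 through half the offset, then all depths through
  the walk, then the arcs through first return.\<close>

lemma noncr_symsum_inj:
  assumes N: "odd N"
  shows "inj_on (symsum (brk N)) (noncr N)"
proof (rule inj_onI)
  fix B C assume B: "B \<in> noncr N" and C: "C \<in> noncr N" and eq: "symsum (brk N) B = symsum (brk N) C"
  have BP: "B \<in> PN N" and CP: "C \<in> PN N" using B C by (auto simp: noncr_def)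
  have "depth N B 0 = depth N C 0"
    using offset_noncr[OF N B] offset_noncr[OF N C] eq by (intro zeta_inj) simp
  then have "depth N B p = depth N C p" if "p \<le> N" for p
    using depth_walk[OF B that] depth_walk[OF C that] eq by simp
  then have "matched N (depth N B) i j \<longleftrightarrow> matched N (depth N C) i j" for i j by (rule matched_cong)
  then have "arcs B = arcs C" using arcs_iff_matched[OF B] arcs_iff_matched[OF C] by auto
  then show "B = C" using PN_eq_arcs[OF BP] PN_eq_arcs[OF CP] by simp
qed

text \<open>The offset is twice an integer and has the parity of the cardinality.\<close>

lemma noncr_symsum_EN:
  assumes N: "odd N" and B: "B \<in> noncr N"
  shows "symsum (brk N) B \<in> EN N"
proof -
  have BP: "B \<in> PN N" using B by (auto simp: noncr_def)
  have "even (card (symsum (brk N) B \<inter> {1..N}))"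
    using offset_noncr[OF N B] even_offset[of "symsum (brk N) B" N] by simp
  then show ?thesis using PN_symsum_brk_subset[OF BP] by (auto simp: EN_def Int_absorb2)
qed

section \<open>From closed walks back to matchings\<close>

text \<open>The properties of a depth sequence from which a matching can be rebuilt. Level steps are
  confined to depth 0, where unmatched points sit.\<close>

definition closed_walk :: "nat \<Rightarrow> (nat \<Rightarrow> nat) \<Rightarrow> bool" where
  "closed_walk N d \<longleftrightarrow> d N = d 0 \<and>
     (\<forall>p \<in> {1..N}. d p = Suc (d (p - 1)) \<or> d (p - 1) = Suc (d p) \<or> (d (p - 1) = 0 \<and> d p = 0))"

lemma closed_walk_cases:
  assumes "closed_walk N d" "1 \<le> p" "p \<le> N"
  obtains "d p = Suc (d (p - 1))" | "d (p - 1) = Suc (d p)" | "d (p - 1) = 0" "d p = 0"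
  using assms unfolding closed_walk_def by (meson atLeastAtMost_iff)

text \<open>A step lowers the walk by at most one, so it cannot jump past the level k.\<close>

lemma first_descent:
  assumes d: "closed_walk N d" and j: "j \<le> N" and lt: "k < d (j - 1)" and le: "d j \<le> k" and 1: "1 \<le> j"
  shows "d j = k" "d (j - 1) = Suc k"
  using lt le by (auto intro: closed_walk_cases[OF d 1 j])

text \<open>The first return is searched from i up to N and, failing that, again from gap 0.\<close>

lemma closed_walk_match_right:
  assumes d: "closed_walk N d" and i: "1 \<le> i" "i \<le> N" and up: "d i = Suc (d (i - 1))"
  shows "\<exists>j. matched N d i j"
proof (cases "\<exists>j. i < j \<and> j \<le> N \<and> d j \<le> d (i - 1)")
  case True
  define j where "j = (LEAST j. i < j \<and> j \<le> N \<and> d j \<le> d (i - 1))"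
  have j: "i < j" "j \<le> N" "d j \<le> d (i - 1)"
    using LeastI_ex[OF True] by (simp_all only: j_def)
  have lt: "d (i - 1) < d p" if "p \<in> {i..<j}" for p
  proof (cases "p = i")
    case False
    then show ?thesis using not_less_Least[of p "\<lambda>j. i < j \<and> j \<le> N \<and> d j \<le> d (i - 1)"] that j
      unfolding j_def by force
  qed (simp add: up)
  have "d j = d (i - 1)" "d (j - 1) = Suc (d (i - 1))"
    using first_descent[OF d j(2) lt[of "j - 1"] j(3)] j(1) by auto
  then have "matched N d i j"
    using i j lt up by (auto simp: matched_def gap_def Suc_le_eq)
  then show ?thesis ..
next
  case False
  then have gt: "d (i - 1) < d p" if "p \<in> {i..N}" for p
    using that up by (metis atLeastAtMost_iff lessI linorder_not_less order_le_imp_less_or_eq)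
  \<comment> \<open>Gap \<open>i - 1\<close> itself qualifies, so the search from 0 stops before i.
    It does not stop at 0, because gap 0 has the depth of gap N, which is still too high.\<close>
  define j where "j = (LEAST j. d j \<le> d (i - 1))"
  have j: "d j \<le> d (i - 1)" unfolding j_def by (rule LeastI) (rule order_refl)
  have "j \<le> i - 1" unfolding j_def by (rule Least_le) (rule order_refl)
  have lt: "d (i - 1) < d p" if "p < j" for p
    using not_less_Least[of p "\<lambda>j. d j \<le> d (i - 1)"] that unfolding j_def by simp
  have "d 0 = d N" using d by (simp add: closed_walk_def)
  then have "d (i - 1) < d 0" using gt[of N] i by simp
  then have "1 \<le> j" using j by (cases j) auto
  then have "d j = d (i - 1)" "d (j - 1) = Suc (d (i - 1))"
    using first_descent[OF d _ lt[of "j - 1"] j] i \<open>j \<le> i - 1\<close> by auto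
  then have "matched N d i j"
    using i \<open>1 \<le> j\<close> \<open>j \<le> i - 1\<close> lt gt up by (auto simp: matched_def gap_def Suc_le_eq)
  then show ?thesis ..
qed

text \<open>The mirror search backwards from j. The condition is put on \<open>i - 1\<close>, the
  gap in front of a candidate start, where the walk is still low.\<close>

lemma closed_walk_match_left:
  assumes d: "closed_walk N d" and j: "1 \<le> j" "j \<le> N" and down: "d (j - 1) = Suc (d j)"
  shows "\<exists>i. matched N d i j"
proof -
  have last_ascent: "d (i - 1) = d j \<and> d i = Suc (d j)"
    if "1 \<le> i" "i \<le> N" "d (i - 1) \<le> d j" "d j < d i" for i
    using that(3,4) by (auto intro: closed_walk_cases[OF d that(1,2)])
  show ?thesis
  proof (cases "\<exists>i. i < j \<and> 1 \<le> i \<and> d (i - 1) \<le> d j")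
    case True
    define i where "i = (GREATEST i. i < j \<and> 1 \<le> i \<and> d (i - 1) \<le> d j)"
    have b: "\<And>y. y < j \<and> 1 \<le> y \<and> d (y - 1) \<le> d j \<Longrightarrow> y \<le> j" by simp
    have i: "i < j" "1 \<le> i" "d (i - 1) \<le> d j"
      using GreatestI_ex_nat[OF True b] by (simp_all only: i_def)
    have lt: "d j < d p" if "p \<in> {i..<j}" for p
    proof (cases "p = j - 1")
      case False
      then have "Suc p < j" using that by auto
      then show ?thesis using Greatest_le_nat[of "\<lambda>i. i < j \<and> 1 \<le> i \<and> d (i - 1) \<le> d j" "Suc p", OF _ b] that
        unfolding i_def by force
    qed (use down in simp)
    have "d (i - 1) = d j" "d i = Suc (d j)"
      using last_ascent[OF i(2) _ i(3) lt] i j by auto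
    then have "matched N d i j"
      using i j lt down by (auto simp: matched_def gap_def Suc_le_eq)
    then show ?thesis ..
  next
    case False
    have gt: "d j < d p" if "p < j" for p
    proof (cases "p = j - 1")
      case False
      then have "Suc p < j" using that by auto
      then show ?thesis using \<open>\<not> (\<exists>i. i < j \<and> 1 \<le> i \<and> d (i - 1) \<le> d j)\<close> by force
    qed (use down in simp)
    define i where "i = (GREATEST i. i \<le> N \<and> 1 \<le> i \<and> d (i - 1) \<le> d j)"
    have "d N = d 0" using d by (simp add: closed_walk_def)
    then have "d j < d N" using gt[of 0] j by simp
    \<comment> \<open>Gap j, seen as the gap in front of \<open>Suc j\<close>, guarantees that the
      backward search from N succeeds. The depth at N is too high for j to be N.\<close>
    then have "Suc j \<le> N \<and> 1 \<le> Suc j \<and> d (Suc j - 1) \<le> d j" using j by (cases "j = N") auto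
    note ex = this
    have b: "\<And>y. y \<le> N \<and> 1 \<le> y \<and> d (y - 1) \<le> d j \<Longrightarrow> y \<le> N" by simp
    have i: "i \<le> N" "1 \<le> i" "d (i - 1) \<le> d j"
      using GreatestI_nat[of "\<lambda>i. i \<le> N \<and> 1 \<le> i \<and> d (i - 1) \<le> d j", OF ex b] by (simp_all only: i_def)
    have "Suc j \<le> i" unfolding i_def
      using Greatest_le_nat[of "\<lambda>i. i \<le> N \<and> 1 \<le> i \<and> d (i - 1) \<le> d j", OF ex b] .
    have lt: "d j < d p" if "p \<in> {i..N}" for p
    proof (cases "p = N")
      case False
      then show ?thesis using Greatest_le_nat[of "\<lambda>i. i \<le> N \<and> 1 \<le> i \<and> d (i - 1) \<le> d j" "Suc p", OF _ b] that
        unfolding i_def by force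
    qed (use \<open>d j < d N\<close> in simp)
    have "d (i - 1) = d j" "d i = Suc (d j)"
      using last_ascent[OF i(2,1) i(3) lt] i by auto
    then have "matched N d i j"
      using i j lt gt down \<open>Suc j \<le> i\<close> by (auto simp: matched_def gap_def Suc_le_eq)
    then show ?thesis ..
  qed
qed

text \<open>Every step up or down preserves the parity of \<open>d p + p\<close>; a level step joins
  two zero depths, which \<open>pos\<close> excludes.\<close>

lemma closed_walk_parity:
  assumes d: "closed_walk N d" and "a \<le> b" "b \<le> N"
    and pos: "\<And>p. a < p \<Longrightarrow> p \<le> b \<Longrightarrow> 0 < d (p - 1) \<or> 0 < d p"
  shows "even (d a + a) \<longleftrightarrow> even (d b + b)"
  using assms(2,3) pos
proof (induction b rule: dec_induct)
  case (step n)
  then have "even (d a + a) \<longleftrightarrow> even (d n + n)" by simp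
  moreover have "d (Suc n) = Suc (d n) \<or> d n = Suc (d (Suc n))"
    using closed_walk_cases[OF d, of "Suc n"] step.prems(1) step.prems(2)[of "Suc n"] step.hyps(1) by fastforce
  ultimately show ?case by auto
qed simp

text \<open>All gaps of the arc have positive depth, so the parity of \<open>d p + p\<close> is kept
  from gap i - 1 to gap j, where the depths are equal. Without wrapping this makes i + j odd; with
  wrapping, the jump from N to 0 changes the parity of the position because N is odd.\<close>

lemma matched_parity:
  assumes N: "odd N" and d: "closed_walk N d" and m: "matched N d i j"
  shows "i < j \<longleftrightarrow> odd (i + j)"
proof -
  note m = matchedD[OF m]
  have gt: "0 < d p" if "p \<in> gap N i j" for p using m(9)[OF that] m(6) by linarith
  show ?thesis
  proof (cases "i < j")
    case True
    have "even (d (i - 1) + (i - 1)) \<longleftrightarrow> even (d j + j)"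
    proof (rule closed_walk_parity[OF d])
      fix p assume "i - 1 < p" "p \<le> j"
      then have "p - 1 \<in> gap N i j \<or> p \<in> gap N i j" using True by (auto simp: gap_def)
      then show "0 < d (p - 1) \<or> 0 < d p" using gt[of p] gt[of "p - 1"] by fastforce
    qed (use True m in auto)
    then show ?thesis using True m(1,8) by auto
  next
    case False
    have "even (d 0 + 0) \<longleftrightarrow> even (d j + j)"
    proof (rule closed_walk_parity[OF d])
      fix p assume "0 < p" "p \<le> j"
      then have "p - 1 \<in> gap N i j" using False by (auto simp: gap_def)
      then show "0 < d (p - 1) \<or> 0 < d p" using gt[of p] gt[of "p - 1"] by fastforce
    qed (use m in auto)
    moreover have "even (d (i - 1) + (i - 1)) \<longleftrightarrow> even (d N + N)"
    proof (rule closed_walk_parity[OF d])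
      fix p assume "i - 1 < p" "p \<le> N"
      then have "p \<in> gap N i j" using False by (auto simp: gap_def)
      then show "0 < d (p - 1) \<or> 0 < d p" using gt[of p] gt[of "p - 1"] by fastforce
    qed (use m in auto)
    moreover have "d N = d 0" using d by (simp add: closed_walk_def)
    ultimately show ?thesis using False N m(1,8) by auto
  qed
qed

definition arcs_of :: "nat \<Rightarrow> (nat \<Rightarrow> nat) \<Rightarrow> nat set set" where
  "arcs_of N d = {{i, j} | i j. matched N d i j}"

text \<open>By parity, the orientation read off from a pair is the direction of the first return
  that created it.\<close>

lemma arcs_arcs_of:
  assumes N: "odd N" and d: "closed_walk N d"
  shows "(i, j) \<in> arcs (arcs_of N d) \<longleftrightarrow> matched N d i j"
proof
  assume "(i, j) \<in> arcs (arcs_of N d)"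
  then obtain k l where kl: "{i, j} = {k, l}" "matched N d k l" and ij: "i < j \<longleftrightarrow> odd (i + j)" "i \<noteq> j"
    by (auto simp: arcs_def arcs_of_def)
  have "\<not> (i = l \<and> j = k)" using matched_parity[OF N d kl(2)] ij by (auto simp: add.commute)
  then show "matched N d i j" using kl by (auto simp: doubleton_eq_iff)
next
  assume m: "matched N d i j"
  then show "(i, j) \<in> arcs (arcs_of N d)"
    using matched_parity[OF N d m] matchedD(5)[OF m] by (auto simp: arcs_def arcs_of_def)
qed

text \<open>The walk rises at a start and falls at an end, so no point is both, and either end
  determines the other.\<close>

lemma arcs_of_PN: "arcs_of N d \<in> PN N"
proof -
  have "{i, j} = {k, l}" if m: "matched N d i j" "matched N d k l" "{i, j} \<inter> {k, l} \<noteq> {}" for i j k l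
  proof -
    have "i \<noteq> l" using matchedD(6)[OF m(1)] matchedD(7)[OF m(2)] by auto
    moreover have "j \<noteq> k" using matchedD(7)[OF m(1)] matchedD(6)[OF m(2)] by auto
    ultimately have "i = k \<or> j = l" using m(3) by auto
    then show ?thesis using m(1,2) matched_unique_left matched_unique_right by blast
  qed
  then have "\<forall>X \<in> arcs_of N d. \<forall>Y \<in> arcs_of N d. X \<noteq> Y \<longrightarrow> X \<inter> Y = {}"
    unfolding arcs_of_def by blast
  moreover have "X \<subseteq> {1..N} \<and> card X = 2" if "X \<in> arcs_of N d" for X
    using that by (auto simp: arcs_of_def matched_def)
  ultimately show ?thesis by (simp add: PN_def)
qed

text \<open>On both sides of an interior point q the depth is at least \<open>d i\<close>, hence
  positive, so the walk rises or falls at q and q has a partner. The arc at q stays inside, because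
  at gaps i - 1 and j the walk is below \<open>d i\<close>.\<close>

lemma arcs_of_noncr:
  assumes N: "odd N" and d: "closed_walk N d"
  shows "arcs_of N d \<in> noncr N"
proof -
  have "\<exists>k l. matched N d k l \<and> q \<in> {k, l} \<and> cyc N k l \<subseteq> cyc N i j - {i, j}"
    if m: "matched N d i j" and q: "q \<in> cyc N i j - {i, j}" for i j q
  proof -
    note mD = matchedD[OF m]
    have qr: "1 \<le> q" "q \<le> N" using q mD(1-5) by (auto simp: cyc_def split: if_splits)
    have "q - 1 \<in> gap N i j" "q \<in> gap N i j" using gap_pred_iff[OF qr mD(1-5)] q by auto
    then have dq: "d i \<le> d (q - 1)" "d i \<le> d q" using mD(9) by auto
    have j: "d j < d i" "d (i - 1) < d i" using mD(6,8) by auto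
    show ?thesis
    proof (rule closed_walk_cases[OF d qr])
      assume "d q = Suc (d (q - 1))"
      then obtain l where l: "matched N d q l" using closed_walk_match_right[OF d qr] by blast
      note lD = matchedD[OF l]
      have "j \<notin> gap N q l" using lD(6) lD(9)[of j] dq j by linarith
      moreover have "l \<noteq> j" using lD(8) dq j by auto
      ultimately have "cyc N q l \<subseteq> cyc N i j - {i, j}"
        using q lD(1-5) mD(1-5) by (auto simp: cyc_def gap_def split: if_splits)
      then show ?thesis using l by blast
    next
      assume "d (q - 1) = Suc (d q)"
      then obtain k where k: "matched N d k q" using closed_walk_match_left[OF d qr] by blast
      note kD = matchedD[OF k]
      have "i - 1 \<notin> gap N k q" using kD(6,8) kD(9)[of "i - 1"] dq j by linarith
      moreover have "k \<noteq> i" using kD(8) dq j by auto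
      ultimately have "cyc N k q \<subseteq> cyc N i j - {i, j}"
        using q kD(1-5) mD(1-5) by (auto simp: cyc_def gap_def split: if_splits)
      then show ?thesis using k by blast
    next
      assume "d (q - 1) = 0" "d q = 0"
      then show ?thesis using dq mD(6) by linarith
    qed
  qed
  then show ?thesis using arcs_of_PN by (simp add: noncr_def arcs_arcs_of[OF N d])
qed

text \<open>Both functions make the same steps, so their difference is constant. It vanishes at a
  level step, where both are 0.\<close>

lemma depth_arcs_of:
  assumes N: "odd N" and d: "closed_walk N d" and p: "p \<le> N"
  shows "depth N (arcs_of N d) p = d p"
proof -
  let ?B = "arcs_of N d"
  note B = arcs_of_noncr[OF N d] and BP = arcs_of_PN[of N d]
  note a = arcs_arcs_of[OF N d]
  have flat: "p \<notin> supp ?B" if "d (p - 1) = 0" "d p = 0" for p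
  proof (rule point_cases[OF BP, of p])
    fix l assume "(p, l) \<in> arcs ?B"
    then show ?thesis using matchedD(6) that a by fastforce
  next
    fix k assume "(k, p) \<in> arcs ?B"
    then show ?thesis using matchedD(7) that a by fastforce
  qed
  have const: "int (depth N ?B p) - int (d p) = int (depth N ?B 0) - int (d 0)" if "p \<le> N" for p
    using that
  proof (induction p)
    case (Suc p)
    then have IH: "int (depth N ?B p) - int (d p) = int (depth N ?B 0) - int (d 0)" by simp
    have p: "1 \<le> Suc p" "Suc p \<le> N" using Suc.prems by auto
    show ?case
    proof (rule closed_walk_cases[OF d p])
      assume up: "d (Suc p) = Suc (d (Suc p - 1))"
      then obtain l where "(Suc p, l) \<in> arcs ?B" using closed_walk_match_right[OF d p] a by blast
      from depth_open(1)[OF BP this] up IH show ?thesis by simp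
    next
      assume down: "d (Suc p - 1) = Suc (d (Suc p))"
      then obtain k where "(k, Suc p) \<in> arcs ?B" using closed_walk_match_left[OF d p] a by blast
      from depth_close(1)[OF BP this] down IH show ?thesis by simp
    next
      assume "d (Suc p - 1) = 0" "d (Suc p) = 0"
      from depth_single[OF B p flat[OF this]] this IH show ?thesis by simp
    qed
  qed simp
  \<comment> \<open>Without a level step, \<open>d p + p\<close> would keep its parity around the
    circle, while d returns to its initial value and p advances by the odd number N.\<close>
  have "\<exists>p \<in> {1..N}. d (p - 1) = 0 \<and> d p = 0"
  proof (rule ccontr)
    assume "\<not> ?thesis"
    then have "even (d 0 + 0) \<longleftrightarrow> even (d N + N)" by (intro closed_walk_parity[OF d]) auto
    then show False using N d by (simp add: closed_walk_def)
  qed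
  then obtain q where q: "1 \<le> q" "q \<le> N" "d (q - 1) = 0" "d q = 0" by auto
  then have "depth N ?B q = d q" using depth_single[OF B q(1,2) flat] by simp
  then show ?thesis using const[OF q(2)] const[OF p] by simp
qed

text \<open>For surjectivity, evenness of X makes the offset even. Half of it is \<open>zeta\<close>
  of a starting depth whose walk closes up, and first return turns that walk into a
  matching.\<close>

theorem noncr_symsum_bij:
  assumes N: "odd N"
  shows "bij_betw (symsum (brk N)) (noncr N) (EN N)"
  unfolding bij_betw_def
proof
  show "symsum (brk N) ` noncr N = EN N"
  proof (intro subset_antisym subsetI)
    fix X assume X: "X \<in> EN N"
    then have XN: "X \<subseteq> {1..N}" "even (card (X \<inter> {1..N}))" by (auto simp: EN_def Int_absorb2)
    then have "even (offset X N)" using even_offset[of X N] by simp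
    then obtain z where "offset X N = 2 * z" ..
    moreover obtain s where "zeta s = z" using zeta_surj by blast
    ultimately have s: "walk X s N = s" by (simp add: walk_fixpoint_iff[OF N])
    have st: "walk X s p = step (p \<in> X) (walk X s (p - 1))" if "1 \<le> p" for p
      using that by (cases p) auto
    have d: "closed_walk N (walk X s)" unfolding closed_walk_def
    proof (intro conjI ballI)
      fix p assume "p \<in> {1..N}"
      then show "walk X s p = Suc (walk X s (p - 1)) \<or> walk X s (p - 1) = Suc (walk X s p) \<or>
          (walk X s (p - 1) = 0 \<and> walk X s p = 0)"
        using st[of p] step_cases[of "p \<in> X" "walk X s (p - 1)"] by simp
    qed (simp add: s)
    let ?B = "arcs_of N (walk X s)"
    have B: "?B \<in> noncr N" by (rule arcs_of_noncr[OF N d])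
    have "p \<in> symsum (brk N) ?B \<longleftrightarrow> p \<in> X" if p: "1 \<le> p" "p \<le> N" for p
    \<comment> \<open>Equal depths before and after p force the same membership bit at p.\<close>
    proof (rule step_inj)
      show "step (p \<in> symsum (brk N) ?B) (walk X s (p - 1)) = step (p \<in> X) (walk X s (p - 1))"
        using depth_step[OF B p] st[OF p(1)] depth_arcs_of[OF N d, of p] depth_arcs_of[OF N d, of "p - 1"] p
        by simp
    qed
    then have "symsum (brk N) ?B = X"
      using XN(1) PN_symsum_brk_subset[OF arcs_of_PN, of N "walk X s"] by (auto simp: subset_iff)
    then show "X \<in> symsum (brk N) ` noncr N" using B by blast
  qed (use noncr_symsum_EN[OF N] in auto)
qed (rule noncr_symsum_inj[OF N])

subsection \<open>Covered intervals and nested sequences\<close>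

lemma B1_iff_arcs: "(i, j) \<in> B1 B \<longleftrightarrow> (i, j) \<in> arcs B \<and> i < j"
  by (auto simp: B1_def arcs_def)

lemma B0_iff_arcs: "(i, j) \<in> B0 B \<longleftrightarrow> (i, j) \<in> arcs B \<and> j < i"
  by (auto simp: B0_def arcs_def)

lemma arcs_iff_B01: "(i, j) \<in> arcs B \<longleftrightarrow> (i, j) \<in> B1 B \<or> (i, j) \<in> B0 B"
  unfolding B1_iff_arcs B0_iff_arcs by (auto simp: arcs_def)

text \<open>A pointwise counterpart of \<open>cov0\<close> that also accounts for arcs nested inside
  the covering intervals; this is the form in which \<open>noncr\<close> speaks.\<close>

definition fully_matched :: "nat set set \<Rightarrow> nat set \<Rightarrow> bool" where
  "fully_matched B I \<longleftrightarrow> (\<forall>q \<in> I. \<exists>i j. (i, j) \<in> B1 B \<and> q \<in> {i, j} \<and> {i..j} \<subseteq> I)"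

lemma fully_matchedE:
  assumes "fully_matched B I" "q \<in> I"
  obtains i j where "(i, j) \<in> B1 B" "q \<in> {i, j}" "{i..j} \<subseteq> I"
  using assms unfolding fully_matched_def by blast

lemma cov0_empty: "cov0 B {}"
  unfolding cov0_def by (intro exI[of _ "{}"]) auto

lemma cov0_arc:
  assumes "(i, j) \<in> B1 B"
  shows "cov0 B {i..j}"
  unfolding cov0_def using assms by (intro exI[of _ "{(i, j)}"]) auto

lemma cov0_Un:
  assumes "cov0 B X" "cov0 B Y" "X \<inter> Y = {}"
  shows "cov0 B (X \<union> Y)"
proof -
  obtain P where P: "P \<subseteq> B1 B" "X = (\<Union>p\<in>P. {fst p..snd p})"
    "\<forall>p\<in>P. \<forall>q\<in>P. p \<noteq> q \<longrightarrow> {fst p..snd p} \<inter> {fst q..snd q} = {}"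
    using assms(1) unfolding cov0_def by blast
  obtain Q where Q: "Q \<subseteq> B1 B" "Y = (\<Union>p\<in>Q. {fst p..snd p})"
    "\<forall>p\<in>Q. \<forall>q\<in>Q. p \<noteq> q \<longrightarrow> {fst p..snd p} \<inter> {fst q..snd q} = {}"
    using assms(2) unfolding cov0_def by blast
  have PQ: "{fst p..snd p} \<inter> {fst q..snd q} = {}" if "p \<in> P" "q \<in> Q" for p q
    using assms(3) P(2) Q(2) that by blast
  have "\<forall>p\<in>P \<union> Q. \<forall>q\<in>P \<union> Q. p \<noteq> q \<longrightarrow> {fst p..snd p} \<inter> {fst q..snd q} = {}"
    using P(3) Q(3) PQ by blast
  moreover have "X \<union> Y = (\<Union>p\<in>P \<union> Q. {fst p..snd p})" using P(2) Q(2) by blast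
  moreover have "P \<union> Q \<subseteq> B1 B" using P(1) Q(1) by blast
  ultimately show ?thesis unfolding cov0_def by (intro exI[of _ "P \<union> Q"] conjI)
qed

lemma cov0_mono:
  assumes "cov0 B X" "B1 B \<subseteq> B1 C"
  shows "cov0 C X"
proof -
  obtain P where P: "P \<subseteq> B1 B" "\<forall>p\<in>P. \<forall>q\<in>P. p \<noteq> q \<longrightarrow> {fst p..snd p} \<inter> {fst q..snd q} = {}"
    "X = (\<Union>p\<in>P. {fst p..snd p})"
    using assms(1) unfolding cov0_def by blast
  then show ?thesis unfolding cov0_def using subset_trans[OF P(1) assms(2)]
    by (intro exI[of _ P] conjI)
qed

lemma cov0_even:
  assumes B: "B \<in> PN N" and X: "cov0 B X"
  shows "even (card X)"
proof -
  obtain P where P: "P \<subseteq> B1 B" "X = (\<Union>p\<in>P. {fst p..snd p})"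
    "\<forall>p\<in>P. \<forall>q\<in>P. p \<noteq> q \<longrightarrow> {fst p..snd p} \<inter> {fst q..snd q} = {}"
    using X unfolding cov0_def by blast
  have "B1 B \<subseteq> arcs B" by (auto simp: B1_iff_arcs)
  then have "finite P" using P(1) arcs_finite[OF B] by (meson finite_subset)
  then have "card X = (\<Sum>p\<in>P. card {fst p..snd p})"
    unfolding P(2) using P(3) by (intro card_UN_disjoint) auto
  moreover have "even (card {fst p..snd p})" if "p \<in> P" for p
    using P(1) that by (cases p) (auto simp: B1_def)
  ultimately show ?thesis by (simp add: dvd_sum)
qed

text \<open>Induction on the length: the intervals covering the interior are themselves shorter
  arcs.\<close>

lemma arc_fully_matched:
  assumes S: "\<And>i j. (i, j) \<in> B1 B \<Longrightarrow> cov0 B {i+1..j-1}" and ij: "(i, j) \<in> B1 B"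
  shows "fully_matched B {i..j}"
  using ij
proof (induction "j - i" arbitrary: i j rule: less_induct)
  case less
  obtain P where P: "P \<subseteq> B1 B" "{i+1..j-1} = (\<Union>p\<in>P. {fst p..snd p})"
    using S[OF less.prems] unfolding cov0_def by blast
  show ?case unfolding fully_matched_def
  proof
    fix q assume q: "q \<in> {i..j}"
    show "\<exists>k l. (k, l) \<in> B1 B \<and> q \<in> {k, l} \<and> {k..l} \<subseteq> {i..j}"
    proof (cases "q \<in> {i, j}")
      case False
      then have "q \<in> {i+1..j-1}" using q by auto
      then have "q \<in> (\<Union>p\<in>P. {fst p..snd p})" by (simp only: P(2))
      then obtain k l where kl: "(k, l) \<in> P" "q \<in> {k..l}" by auto
      then have kl1: "(k, l) \<in> B1 B" using P(1) by blast
      have sub: "{k..l} \<subseteq> {i+1..j-1}" using P(2) kl(1) by force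
      have "k < l" using kl1 by (simp add: B1_iff_arcs)
      then have "i + 1 \<le> k" "l \<le> j - 1" using sub by auto
      then have "l - k < j - i" using \<open>k < l\<close> by linarith
      from less.hyps[OF this kl1] kl(2) obtain a b
        where "(a, b) \<in> B1 B" "q \<in> {a, b}" "{a..b} \<subseteq> {k..l}"
        unfolding fully_matched_def by blast
      then show ?thesis using sub by (metis \<open>i + 1 \<le> k\<close> \<open>l \<le> j - 1\<close> atLeastatMost_subset_iff
            add_leD1 diff_le_self dual_order.trans)
    qed (use less.prems in blast)
  qed
qed

lemma cov0_fully_matched:
  assumes S: "\<And>i j. (i, j) \<in> B1 B \<Longrightarrow> cov0 B {i+1..j-1}" and X: "cov0 B X"
  shows "fully_matched B X"
proof -
  obtain P where P: "P \<subseteq> B1 B" "X = (\<Union>p\<in>P. {fst p..snd p})"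
    using X unfolding cov0_def by blast
  show ?thesis unfolding fully_matched_def
  proof
    fix q assume "q \<in> X"
    then obtain k l where kl: "(k, l) \<in> P" "q \<in> {k..l}" using P(2) by auto
    then have "fully_matched B {k..l}" using P(1) arc_fully_matched[OF S] by blast
    moreover have "{k..l} \<subseteq> X" using P(2) kl(1) by force
    ultimately show "\<exists>i j. (i, j) \<in> B1 B \<and> q \<in> {i, j} \<and> {i..j} \<subseteq> X"
      using kl(2) unfolding fully_matched_def by (meson subset_trans)
  qed
qed

text \<open>Greedy from the left: the arc at a must start there since it lies in the interval. After
  it is split off, the remainder is again fully matched.\<close>

lemma fully_matched_cov0:
  assumes B: "B \<in> PN N" and S: "\<And>i j. (i, j) \<in> B1 B \<Longrightarrow> fully_matched B {i+1..j-1}"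
    and X: "fully_matched B {a..b}"
  shows "cov0 B {a..b}"
  using X
proof (induction "b + 1 - a" arbitrary: a rule: less_induct)
  case less
  show ?case
  proof (cases "a \<le> b")
    case True
    then obtain i j where ij: "(i, j) \<in> B1 B" "a \<in> {i, j}" "{i..j} \<subseteq> {a..b}"
      using less.prems unfolding fully_matched_def by (meson atLeastAtMost_iff order_refl)
    have "i < j" using ij(1) by (simp add: B1_iff_arcs)
    then have r: "a \<le> i" "j \<le> b" using ij(3) by auto
    then have [simp]: "i = a" using ij(2) \<open>i < j\<close> by auto
    have aj: "(a, j) \<in> arcs B" using ij(1) by (simp add: B1_iff_arcs)
    have "fully_matched B {j+1..b}" unfolding fully_matched_def
    proof
      fix q assume q: "q \<in> {j+1..b}"
      then obtain k l where kl: "(k, l) \<in> B1 B" "q \<in> {k, l}" "{k..l} \<subseteq> {a..b}"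
        using less.prems \<open>i < j\<close> unfolding fully_matched_def
        by (metis (no_types, lifting) \<open>i = a\<close> Suc_eq_plus1 Suc_leD atLeastAtMost_iff less_imp_le_nat order_trans)
      have kl': "(k, l) \<in> arcs B" "k < l" using kl(1) by (auto simp: B1_iff_arcs)
      have "k \<noteq> a" using arcs_unique(1)[OF B aj, of l] kl(2) kl' q \<open>i < j\<close> by auto
      moreover have "k \<noteq> j" using arcs_unique(3)[OF B aj, of l] kl'(1) by auto
      \<comment> \<open>By \<open>S\<close>, an arc starting strictly under (a, j) also ends there
        and cannot reach q beyond j.\<close>
      moreover have "k \<notin> {a+1..j-1}"
      proof
        assume "k \<in> {a+1..j-1}"
        then obtain k' l' where k': "(k', l') \<in> B1 B" "k \<in> {k', l'}" "{k'..l'} \<subseteq> {a+1..j-1}"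
          using S[OF ij(1)] by (simp only: \<open>i = a\<close>) (elim fully_matchedE)
        then have "k' = k \<and> l' = l"
          using arcs_eq[OF B, of k' l' k l] kl'(1) by (simp add: B1_iff_arcs)
        then have "l \<le> j - 1" using k'(3) kl'(2) by auto
        then show False using kl(2) kl'(2) q by auto
      qed
      moreover have "a \<le> k" "l \<le> b" using kl(3) kl'(2) by auto
      ultimately have "j + 1 \<le> k" using \<open>i < j\<close> by (auto simp: not_le)
      then have "{k..l} \<subseteq> {j+1..b}" using \<open>l \<le> b\<close> by auto
      then show "\<exists>k l. (k, l) \<in> B1 B \<and> q \<in> {k, l} \<and> {k..l} \<subseteq> {j+1..b}" using kl by blast
    qed
    moreover have "b + 1 - (j + 1) < b + 1 - a" using r \<open>i < j\<close> by auto
    ultimately have "cov0 B {j+1..b}" by (rule less.hyps[rotated])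
    then have "cov0 B ({a..j} \<union> {j+1..b})" using cov0_arc[OF ij(1)] by (intro cov0_Un) auto
    moreover have "{a..j} \<union> {j+1..b} = {a..b}" using r \<open>i < j\<close> by auto
    ultimately show ?thesis by simp
  qed (simp add: cov0_empty)
qed

lemma fully_matched_subset_supp:
  assumes "fully_matched B X"
  shows "X \<subseteq> supp B"
proof
  fix q assume "q \<in> X"
  then obtain i j where "(i, j) \<in> B1 B" "q \<in> {i, j}" using assms unfolding fully_matched_def by blast
  then show "q \<in> supp B" by (auto simp: supp_def B1_def)
qed

lemma noncrE:
  assumes "B \<in> noncr N" "(i, j) \<in> arcs B" "q \<in> cyc N i j - {i, j}"
  obtains k l where "(k, l) \<in> arcs B" "q \<in> {k, l}" "cyc N k l \<subseteq> cyc N i j - {i, j}"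
  using assms unfolding noncr_def by blast

lemma cyc_atLeastAtMost: "i < j \<Longrightarrow> cyc N i j - {i, j} = {i+1..j-1}"
  by (auto simp: cyc_def)

text \<open>An arc nested under (i, j) cannot wrap around, for it would contain N, which is not
  strictly between i and j. So it belongs to \<open>B1 B\<close>.\<close>

lemma noncr_fully_matched:
  assumes B: "B \<in> noncr N" and ij: "(i, j) \<in> B1 B"
  shows "fully_matched B {i+1..j-1}"
proof -
  have BP: "B \<in> PN N" using B by (simp add: noncr_def)
  have a: "(i, j) \<in> arcs B" "i < j" using ij by (auto simp: B1_iff_arcs)
  note r = arcs_range[OF BP]
  note int = cyc_atLeastAtMost[OF a(2), of N]
  have "\<exists>k l. (k, l) \<in> B1 B \<and> q \<in> {k, l} \<and> {k..l} \<subseteq> {i+1..j-1}" if "q \<in> {i+1..j-1}" for q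
  proof -
    have "q \<in> cyc N i j - {i, j}" using that by (simp only: int)
    then obtain k l where kl: "(k, l) \<in> arcs B" "q \<in> {k, l}" "cyc N k l \<subseteq> cyc N i j - {i, j}"
      by (rule noncrE[OF B a(1)])
    note kl(3)[unfolded int]
    note kl = kl(1,2) this
    have "k < l"
    proof (rule ccontr)
      assume "\<not> k < l"
      then have "N \<in> cyc N k l" using r[OF kl(1)] by (auto simp: cyc_def)
      then have "N \<in> {i+1..j-1}" using kl(3) by blast
      then show False using r[OF a(1)] by auto
    qed
    then show ?thesis using kl by (auto simp: B1_iff_arcs cyc_def)
  qed
  then show ?thesis unfolding fully_matched_def by blast
qed

section \<open>Ends of the arcs of even difference\<close>

definition ends0 :: "nat set set \<Rightarrow> nat set" where
  "ends0 B = fst ` B0 B \<union> snd ` B0 B"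

lemma ends0_iff: "x \<in> ends0 B \<longleftrightarrow> (\<exists>y. (x, y) \<in> B0 B \<or> (y, x) \<in> B0 B)"
  by (force simp: ends0_def image_iff)

lemma ends0_not_B1:
  assumes B: "B \<in> PN N" and "(k, l) \<in> B1 B"
  shows "k \<notin> ends0 B" "l \<notin> ends0 B"
proof -
  have "{k, l} \<inter> {x, y} = {}" if "(x, y) \<in> B0 B" for x y
    using arcs_eq[OF B, of k l x y] assms(2) that by (auto simp: B1_iff_arcs B0_iff_arcs)
  then show "k \<notin> ends0 B" "l \<notin> ends0 B" by (auto simp: ends0_iff)
qed

lemma ends0_not_matched:
  assumes B: "B \<in> PN N" and "fully_matched B X" "x \<in> X"
  shows "x \<notin> ends0 B"
  using assms ends0_not_B1[OF B] unfolding fully_matched_def by blast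

lemma ends0_not_inside_B1:
  assumes B: "B \<in> PN N" and "(k, l) \<in> B1 B" "fully_matched B {k+1..l-1}" "x \<in> ends0 B"
  shows "x \<notin> {k..l}"
proof
  assume "x \<in> {k..l}"
  moreover have "x \<noteq> k" "x \<noteq> l" using ends0_not_B1[OF B assms(2)] assms(4) by auto
  ultimately have "x \<in> {k+1..l-1}" by auto
  then show False using ends0_not_matched[OF B assms(3)] assms(4) by blast
qed

text \<open>The interval contains no end of a \<open>B0\<close> arc, so its points are matched by
  \<open>B1\<close> arcs. These cannot pass a - 1 or b + 1, which are ends of \<open>B0\<close> arcs
  unless the interval already reaches 1 or N.\<close>

lemma noncr_cov0:
  assumes B: "B \<in> noncr N" and ij: "(i, j) \<in> B0 B"
    and I: "{a..b} \<subseteq> cyc N i j - {i, j}" "{a..b} \<inter> ends0 B = {}"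
    and a: "a = 1 \<or> a - 1 \<in> ends0 B" and b: "b = N \<or> b + 1 \<in> ends0 B"
  shows "cov0 B {a..b}"
proof -
  have BP: "B \<in> PN N" using B by (simp add: noncr_def)
  have ij': "(i, j) \<in> arcs B" using ij by (simp add: B0_iff_arcs)
  have "fully_matched B {a..b}" unfolding fully_matched_def
  proof
    fix q assume q: "q \<in> {a..b}"
    then obtain k l where kl: "(k, l) \<in> arcs B" "q \<in> {k, l}" "cyc N k l \<subseteq> cyc N i j - {i, j}"
      using B ij' I(1) unfolding noncr_def by blast
    have "q \<notin> ends0 B" using I(2) q by blast
    then have "(k, l) \<notin> B0 B" using kl(2) by (auto simp: ends0_iff)
    then have kl1: "(k, l) \<in> B1 B" using kl(1) arcs_iff_B01 by blast
    note no = ends0_not_inside_B1[OF BP kl1 noncr_fully_matched[OF B kl1]]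
    have r: "1 \<le> k" "l \<le> N" "k < l" using arcs_range[OF BP kl(1)] kl1 by (auto simp: B1_iff_arcs)
    have "a \<le> k" using a no[of "a - 1"] q kl(2) r by fastforce
    moreover have "l \<le> b" using b no[of "b + 1"] q kl(2) r by fastforce
    ultimately show "\<exists>k l. (k, l) \<in> B1 B \<and> q \<in> {k, l} \<and> {k..l} \<subseteq> {a..b}" using kl1 kl(2) by fastforce
  qed
  then show ?thesis using fully_matched_cov0[OF BP noncr_fully_matched[OF B]] by blast
qed

text \<open>Both arcs wrap around. The smaller left end l lies under (i, j), so the whole arc (k, l)
  is nested there.\<close>

lemma noncr_nested:
  assumes B: "B \<in> noncr N" and ij: "(i, j) \<in> B0 B" and kl: "(k, l) \<in> B0 B" and lt: "l < j"
  shows "i < k"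
proof -
  have BP: "B \<in> PN N" using B by (simp add: noncr_def)
  have a: "(i, j) \<in> arcs B" "j < i" "(k, l) \<in> arcs B" "l < k" using ij kl by (auto simp: B0_iff_arcs)
  note r = arcs_range[OF BP a(1)] arcs_range[OF BP a(3)]
  have "l \<in> cyc N i j - {i, j}" using r lt a(2) by (auto simp: cyc_def)
  then have sub: "cyc N k l \<subseteq> cyc N i j - {i, j}" by (intro noncr_interior[OF B a(1,3), of l]) auto
  have "k \<in> cyc N k l" using r by (auto simp: cyc_def)
  then have "k \<in> cyc N i j - {i, j}" using sub by blast
  then have "i < k \<or> k < j" using a(2) r by (auto simp: cyc_def)
  moreover have "\<not> k < j"
  proof
    assume "k < j"
    then have "j \<in> cyc N k l" using r a(4) by (auto simp: cyc_def)
    then show False using sub by blast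
  qed
  ultimately show ?thesis by blast
qed

lemma noncr_left_less_right:
  assumes B: "B \<in> noncr N" and ij: "(i, j) \<in> B0 B" and kl: "(k, l) \<in> B0 B"
  shows "j < k"
proof -
  have a: "j < i" "l < k" using ij kl by (auto simp: B0_iff_arcs)
  show ?thesis
  proof (cases "l < j")
    case True
    then show ?thesis using noncr_nested[OF B ij kl] a by linarith
  qed (use a in linarith)
qed

section \<open>Sequences of nested wrapping arcs\<close>

text \<open>The part of \<open>seq_ok\<close> about positions only. All \<open>B0\<close> arcs wrap
  around, so the pair with indices 1 and \<open>2 * s0 B\<close> spans the smallest cyclic
  interval.\<close>

definition rainbow :: "nat \<Rightarrow> nat set set \<Rightarrow> (nat \<Rightarrow> nat) \<Rightarrow> bool" where
  "rainbow N B i \<longleftrightarrow> strict_mono_on {1..2 * s0 B} i \<and> (\<forall>k \<in> {1..2 * s0 B}. i k \<in> {1..N}) \<and>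
     B0 B = {(i (2 * s0 B + 1 - k), i k) | k. k \<in> {1..s0 B}}"

text \<open>The two ranges of covered stretches in \<open>seq_ok\<close>, joined into one range with
  the middle index \<open>s0 B\<close> left out.\<close>

definition spaced :: "nat set set \<Rightarrow> (nat \<Rightarrow> nat) \<Rightarrow> bool" where
  "spaced B i \<longleftrightarrow> (\<forall>k \<in> {1..<2 * s0 B}. k \<noteq> s0 B \<longrightarrow> cov0 B {i k + 1 .. i (k+1) - 1})"

lemma seq_ok_iff: "seq_ok N B i \<longleftrightarrow> rainbow N B i \<and> spaced B i"
proof -
  have eq: "(\<forall>k \<in> {1..<2 * s0 B}. k \<noteq> s0 B \<longrightarrow> P k) \<longleftrightarrow>
      (\<forall>k \<in> {1..s0 B - 1}. P k) \<and> (\<forall>k \<in> {s0 B + 1..2 * s0 B - 1}. P k)" for P :: "nat \<Rightarrow> bool"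
  proof -
    have "{1..<2 * s0 B} - {s0 B} = {1..s0 B - 1} \<union> {s0 B + 1..2 * s0 B - 1}" by auto
    then show ?thesis by blast
  qed
  show ?thesis unfolding seq_ok_def rainbow_def spaced_def Let_def eq by (simp only: conj_assoc)
qed

lemma rainbowD:
  assumes "rainbow N B i"
  shows "\<And>k l. 1 \<le> k \<Longrightarrow> k < l \<Longrightarrow> l \<le> 2 * s0 B \<Longrightarrow> i k < i l"
    and "\<And>k. 1 \<le> k \<Longrightarrow> k \<le> 2 * s0 B \<Longrightarrow> 1 \<le> i k \<and> i k \<le> N"
    and "\<And>k. 1 \<le> k \<Longrightarrow> k \<le> s0 B \<Longrightarrow> (i (2 * s0 B + 1 - k), i k) \<in> B0 B"
    and "\<And>x y. (x, y) \<in> B0 B \<Longrightarrow> \<exists>k. 1 \<le> k \<and> k \<le> s0 B \<and> x = i (2 * s0 B + 1 - k) \<and> y = i k"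
proof -
  show "i k < i l" if "1 \<le> k" "k < l" "l \<le> 2 * s0 B" for k l
    using assms that unfolding rainbow_def strict_mono_on_def by auto
  show "1 \<le> i k \<and> i k \<le> N" if "1 \<le> k" "k \<le> 2 * s0 B" for k
    using assms that unfolding rainbow_def by auto
  have B0: "B0 B = {(i (2 * s0 B + 1 - k), i k) | k. k \<in> {1..s0 B}}"
    using assms unfolding rainbow_def by blast
  show "(i (2 * s0 B + 1 - k), i k) \<in> B0 B" if "1 \<le> k" "k \<le> s0 B" for k
    unfolding B0 using that by auto
  show "\<exists>k. 1 \<le> k \<and> k \<le> s0 B \<and> x = i (2 * s0 B + 1 - k) \<and> y = i k" if "(x, y) \<in> B0 B" for x y
    using that unfolding B0 by auto
qed

lemma rainbow_ends0:
  assumes "rainbow N B i"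
  shows "ends0 B = i ` {1..2 * s0 B}"
proof (intro subset_antisym subsetI)
  fix x assume "x \<in> ends0 B"
  then obtain y where "(x, y) \<in> B0 B \<or> (y, x) \<in> B0 B" by (auto simp: ends0_iff)
  then obtain k where "1 \<le> k" "k \<le> s0 B" "x = i (2 * s0 B + 1 - k) \<or> x = i k"
    using rainbowD(4)[OF assms] by blast
  then have "x = i (2 * s0 B + 1 - k) \<and> 2 * s0 B + 1 - k \<in> {1..2 * s0 B} \<or> x = i k \<and> k \<in> {1..2 * s0 B}"
    by auto
  then show "x \<in> i ` {1..2 * s0 B}" by blast
next
  fix x assume "x \<in> i ` {1..2 * s0 B}"
  then obtain k where k: "1 \<le> k" "k \<le> 2 * s0 B" "x = i k" by auto
  show "x \<in> ends0 B"
  proof (cases "k \<le> s0 B")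
    case True
    then show ?thesis using rainbowD(3)[OF assms, of k] k by (auto simp: ends0_iff)
  next
    case False
    then have "1 \<le> 2 * s0 B + 1 - k" "2 * s0 B + 1 - k \<le> s0 B" "2 * s0 B + 1 - (2 * s0 B + 1 - k) = k"
      using k by auto
    then show ?thesis using rainbowD(3)[OF assms, of "2 * s0 B + 1 - k"] k(3) by (auto simp: ends0_iff)
  qed
qed

lemma rainbow_no_ends:
  assumes i: "rainbow N B i"
  shows "\<And>k. k \<in> {1..<2 * s0 B} \<Longrightarrow> {i k + 1..i (k + 1) - 1} \<inter> ends0 B = {}"
    and "{1..i 1 - 1} \<inter> ends0 B = {}"
    and "{i (2 * s0 B) + 1..N} \<inter> ends0 B = {}"
proof -
  note mono = rainbowD(1)[OF i]
  have le: "i a \<le> i b" if "1 \<le> a" "a \<le> b" "b \<le> 2 * s0 B" for a b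
    using mono[of a b] that by (cases "a = b") auto
  show "{i k + 1..i (k + 1) - 1} \<inter> ends0 B = {}" if k: "k \<in> {1..<2 * s0 B}" for k
  proof -
    have "i t \<notin> {i k + 1..i (k + 1) - 1}" if "t \<in> {1..2 * s0 B}" for t
      using le[of t k] le[of "k + 1" t] k that mono[of k "k + 1"] by (cases "t \<le> k") auto
    then show ?thesis unfolding rainbow_ends0[OF i] by blast
  qed
  have "i t \<notin> {1..i 1 - 1}" if "t \<in> {1..2 * s0 B}" for t
    using le[of 1 t] that rainbowD(2)[OF i, of 1] by auto
  then show "{1..i 1 - 1} \<inter> ends0 B = {}" unfolding rainbow_ends0[OF i] by blast
  have "i t \<notin> {i (2 * s0 B) + 1..N}" if "t \<in> {1..2 * s0 B}" for t
    using le[of t "2 * s0 B"] that by auto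
  then show "{i (2 * s0 B) + 1..N} \<inter> ends0 B = {}" unfolding rainbow_ends0[OF i] by blast
qed

text \<open>Each stretch is free of ends of \<open>B0\<close> arcs and bounded by such ends or by
  the range 1..N, so it is covered as soon as it lies under some \<open>B0\<close> arc.\<close>

lemma noncr_rainbow_spaced:
  assumes B: "B \<in> noncr N" and i: "rainbow N B i"
  shows "spaced B i"
    and "1 \<le> s0 B \<Longrightarrow> cov0 B {1..i 1 - 1}"
    and "1 \<le> s0 B \<Longrightarrow> cov0 B {i (2 * s0 B) + 1..N}"
proof -
  let ?s = "s0 B"
  note iD = rainbowD[OF i] and no = rainbow_no_ends[OF i] and e = rainbow_ends0[OF i]
  show "spaced B i" unfolding spaced_def
  proof (intro ballI impI)
    fix k assume k: "k \<in> {1..<2 * ?s}" "k \<noteq> ?s"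
    have kk: "i k < i (k + 1)" using iD(1)[of k "k + 1"] k by auto
    \<comment> \<open>Left of the middle, the arc ending at \<open>i (k + 1)\<close> is above the
      stretch; right of it, the arc starting at \<open>i k\<close>.\<close>
    obtain x y where xy: "(x, y) \<in> B0 B" "{i k + 1..i (k+1) - 1} \<subseteq> cyc N x y - {x, y}"
    proof (cases "k < ?s")
      case True
      then have "(i (2 * ?s + 1 - (k + 1)), i (k + 1)) \<in> B0 B" using iD(3)[of "k + 1"] by auto
      moreover have "i (k + 1) < i (2 * ?s + 1 - (k + 1))" using True by (intro iD(1)) auto
      then have "{i k + 1..i (k+1) - 1} \<subseteq>
          cyc N (i (2 * ?s + 1 - (k + 1))) (i (k + 1)) - {i (2 * ?s + 1 - (k + 1)), i (k + 1)}"
        using kk by (auto simp: cyc_def)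
      ultimately show ?thesis using that by blast
    next
      case False
      then have b: "(i k, i (2 * ?s + 1 - k)) \<in> B0 B" using iD(3)[of "2 * ?s + 1 - k"] k by auto
      have "i (2 * ?s + 1 - k) < i k" using False k by (intro iD(1)) auto
      moreover have "i (k + 1) \<le> N" using iD(2)[of "k + 1"] k by auto
      ultimately have "{i k + 1..i (k+1) - 1} \<subseteq>
          cyc N (i k) (i (2 * ?s + 1 - k)) - {i k, i (2 * ?s + 1 - k)}"
        by (auto simp: cyc_def)
      then show ?thesis using that b by blast
    qed
    have "i k \<in> ends0 B" "i (k + 1) \<in> ends0 B" unfolding e using k by auto
    then show "cov0 B {i k + 1..i (k+1) - 1}"
      using noncr_cov0[OF B xy no(1)[OF k(1)]] kk by auto
  qed
  assume s: "1 \<le> ?s"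
  \<comment> \<open>The two outer stretches lie under the arc with indices 1 and
    \<open>2 * s0 B\<close>.\<close>
  then have b: "(i (2 * ?s), i 1) \<in> B0 B" using iD(3)[of 1] by auto
  have lt: "i 1 < i (2 * ?s)" using s by (intro iD(1)) auto
  have "i 1 \<in> ends0 B" "i (2 * ?s) \<in> ends0 B" unfolding e using s by auto
  moreover have "1 \<le> i 1" "i (2 * ?s) \<le> N" using iD(2) s by auto
  moreover from this have "{1..i 1 - 1} \<subseteq> cyc N (i (2 * ?s)) (i 1) - {i (2 * ?s), i 1}"
    "{i (2 * ?s) + 1..N} \<subseteq> cyc N (i (2 * ?s)) (i 1) - {i (2 * ?s), i 1}"
    using lt by (auto simp: cyc_def)
  ultimately show "cov0 B {1..i 1 - 1}" "cov0 B {i (2 * ?s) + 1..N}"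
    using noncr_cov0[OF B b _ no(2)] noncr_cov0[OF B b _ no(3)] by auto
qed

lemma B0_finite:
  assumes "B \<in> PN N"
  shows "finite (B0 B)"
proof (rule finite_subset)
  show "B0 B \<subseteq> arcs B" by (auto simp: B0_iff_arcs)
qed (rule arcs_finite[OF assms])

text \<open>Nesting pairs increasing left ends with decreasing right ends, and every left end
  precedes every right end. So sorting the left ends yields the whole sequence.\<close>

lemma noncr_ex_rainbow:
  assumes B: "B \<in> noncr N"
  shows "\<exists>i. rainbow N B i"
proof -
  have BP: "B \<in> PN N" using B by (simp add: noncr_def)
  let ?s = "s0 B"
  define L where "L = snd ` B0 B"
  have fin: "finite L" using B0_finite[OF BP] by (simp add: L_def)
  have uniq: "x = y" if "(x, j) \<in> B0 B" "(y, j) \<in> B0 B" for x y j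
    using that arcs_unique(2)[OF BP] by (auto simp: B0_iff_arcs)
  then have "card L = ?s" unfolding L_def s0_def by (intro card_image inj_onI) (auto simp: prod_eq_iff)
  define ls where "ls = sorted_list_of_set L"
  have ls: "set ls = L" "length ls = ?s" "sorted_wrt (<) ls"
    unfolding ls_def using fin \<open>card L = ?s\<close> by auto
  define r where "r j = (THE x. (x, j) \<in> B0 B)" for j
  have r: "(x, j) \<in> B0 B \<longleftrightarrow> j \<in> L \<and> x = r j" for x j
  proof
    assume "(x, j) \<in> B0 B"
    then show "j \<in> L \<and> x = r j" unfolding L_def r_def using uniq by (force intro!: the_equality[symmetric])
  next
    assume xj: "j \<in> L \<and> x = r j"
    then obtain y where "(y, j) \<in> B0 B" by (auto simp: L_def)
    then show "(x, j) \<in> B0 B" using xj uniq unfolding r_def by (metis theI)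
  qed
  \<comment> \<open>The list counts from 0. An index k beyond s takes the right end partnered with
    index 2s + 1 - k, which is list entry 2s - k.\<close>
  define i where "i k = (if k \<le> ?s then ls ! (k - 1) else r (ls ! (2 * ?s - k)))" for k
  have lsB0: "(r (ls ! k), ls ! k) \<in> B0 B" if "k < ?s" for k
    using r ls that by (metis nth_mem)
  have lsmono: "ls ! k < ls ! l" if "k < l" "l < ?s" for k l
    using ls that by (simp add: sorted_wrt_iff_nth_less)
  have "strict_mono_on {1..2 * ?s} i"
  proof (rule strict_mono_onI)
    fix k l assume kl: "k \<in> {1..2 * ?s}" "l \<in> {1..2 * ?s}" "k < l"
    consider "l \<le> ?s" | "k \<le> ?s" "?s < l" | "?s < k" using kl by linarith
    then show "i k < i l"
    proof cases
      case 1
      then show ?thesis using kl lsmono[of "k - 1" "l - 1"] by (auto simp: i_def)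
    next
      case 2
      then show ?thesis using kl noncr_left_less_right[OF B lsB0[of "k - 1"] lsB0[of "2 * ?s - l"]]
        by (auto simp: i_def)
    next
      case 3
      then show ?thesis
        using kl noncr_nested[OF B lsB0[of "2 * ?s - k"] lsB0[of "2 * ?s - l"] lsmono]
        by (auto simp: i_def)
    qed
  qed
  moreover have "i k \<in> {1..N}" if k: "k \<in> {1..2 * ?s}" for k
  proof -
    define t where "t = (if k \<le> ?s then k - 1 else 2 * ?s - k)"
    have "t < ?s" using k by (auto simp: t_def)
    then have "(r (ls ! t), ls ! t) \<in> arcs B" using lsB0 by (simp add: B0_iff_arcs)
    from arcs_range[OF BP this] show ?thesis by (auto simp: i_def t_def split: if_splits)
  qed
  moreover have "B0 B = {(i (2 * ?s + 1 - k), i k) | k. k \<in> {1..?s}}"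
  proof (intro subset_antisym subsetI)
    fix p assume p: "p \<in> B0 B"
    obtain x y where xy: "p = (x, y)" by (cases p)
    then have y: "y \<in> L" "x = r y" using p r by auto
    then obtain t where t: "t < ?s" "y = ls ! t" using ls by (metis in_set_conv_nth)
    have "p = (i (2 * ?s + 1 - Suc t), i (Suc t))" using xy y t by (auto simp: i_def)
    then show "p \<in> {(i (2 * ?s + 1 - k), i k) | k. k \<in> {1..?s}}" using t(1) by force
  next
    fix p assume "p \<in> {(i (2 * ?s + 1 - k), i k) | k. k \<in> {1..?s}}"
    then obtain k where k: "1 \<le> k" "k \<le> ?s" "p = (i (2 * ?s + 1 - k), i k)" by auto
    then have "p = (r (ls ! (k - 1)), ls ! (k - 1))" by (auto simp: i_def)
    then show "p \<in> B0 B" using lsB0[of "k - 1"] k by auto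
  qed
  ultimately show ?thesis unfolding rainbow_def by blast
qed

text \<open>Finds the stretch containing q, counting an end to the stretch on its right. The next
  lemma counts it to the stretch on its left, which suits the other side of a wrapping arc.\<close>

lemma locate_below:
  fixes i :: "nat \<Rightarrow> nat"
  assumes "1 \<le> m" "q < i m"
  shows "q < i 1 \<or> (\<exists>t. 1 \<le> t \<and> t < m \<and> i t \<le> q \<and> q < i (t + 1))"
  using assms
proof (induction m rule: nat_induct_at_least)
  case (Suc n)
  show ?case
  proof (cases "q < i n")
    case True
    then show ?thesis using Suc.IH less_SucI by blast
  next
    case False
    then show ?thesis using Suc by (intro disjI2 exI[of _ n]) auto
  qed
qed simp

lemma locate_above:
  fixes i :: "nat \<Rightarrow> nat"
  assumes "m \<le> n" "i m < q"
  shows "i n < q \<or> (\<exists>t. m \<le> t \<and> t < n \<and> i t < q \<and> q \<le> i (t + 1))"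
  using assms
proof (induction n rule: dec_induct)
  case (step n)
  then have "i n < q \<or> (\<exists>t. m \<le> t \<and> t < n \<and> i t < q \<and> q \<le> i (t + 1))" by simp
  then show ?case
  proof
    assume "i n < q"
    then show ?thesis using step.hyps by (cases "i (Suc n) < q") auto
  qed (use less_SucI in blast)
qed simp

text \<open>A point under a \<open>B0\<close> arc is an end of a \<open>B0\<close> arc nested in it
  or lies in a covered stretch. A point under a \<open>B1\<close> arc is handled by
  \<open>S\<close>.\<close>

lemma rainbow_noncr:
  assumes B: "B \<in> PN N" and i: "rainbow N B i" and sp: "spaced B i"
    and S: "\<And>i j. (i, j) \<in> B1 B \<Longrightarrow> cov0 B {i+1..j-1}"
    and out: "1 \<le> s0 B \<Longrightarrow> cov0 B {1..i 1 - 1} \<and> cov0 B {i (2 * s0 B) + 1..N}"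
  shows "B \<in> noncr N"
proof -
  let ?s = "s0 B"
  note iD = rainbowD[OF i]
  have cm: "fully_matched B X" if "cov0 B X" for X
    using cov0_fully_matched[OF _ that] S by blast
  have int: "\<exists>k l. (k, l) \<in> arcs B \<and> q \<in> {k, l} \<and> cyc N k l \<subseteq> I"
    if X: "cov0 B X" "q \<in> X" "X \<subseteq> I" for X q I
  proof -
    obtain k l where "(k, l) \<in> B1 B" "q \<in> {k, l}" "{k..l} \<subseteq> X"
      by (rule fully_matchedE[OF cm[OF X(1)] X(2)])
    then show ?thesis using X(3) by (intro exI[of _ k] exI[of _ l]) (auto simp: B1_iff_arcs cyc_def)
  qed
  have "\<exists>k l. (k, l) \<in> arcs B \<and> q \<in> {k, l} \<and> cyc N k l \<subseteq> cyc N x y - {x, y}"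
    if xy: "(x, y) \<in> arcs B" and q: "q \<in> cyc N x y - {x, y}" for x y q
  proof (cases "x < y")
    case True
    then have "(x, y) \<in> B1 B" using xy by (simp add: B1_iff_arcs)
    from int[OF S[OF this] _ order_refl, of q] show ?thesis
      using q True unfolding cyc_atLeastAtMost[OF True] by simp
  next
    case False
    then have "y < x" using arcs_range[OF B xy] by auto
    then have "(x, y) \<in> B0 B" using xy by (simp add: B0_iff_arcs)
    then obtain m where m: "1 \<le> m" "m \<le> ?s" "x = i (2 * ?s + 1 - m)" "y = i m" using iD(4) by blast
    \<comment> \<open>The index of the right end, so that the interior consists of the points below
      \<open>i m\<close> and those above \<open>i n\<close>.\<close>
    define n where "n = 2 * ?s + 1 - m"
    have n: "?s < n" "n \<le> 2 * ?s" "x = i n" using m by (auto simp: n_def)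
    have I: "cyc N x y - {x, y} = {1..i m - 1} \<union> {i n + 1..N}"
      using \<open>y < x\<close> arcs_range[OF B xy] unfolding n(3) m(4) by (auto simp: cyc_def)
    have int': "\<exists>k l. (k, l) \<in> arcs B \<and> q \<in> {k, l} \<and> cyc N k l \<subseteq> cyc N x y - {x, y}"
      if "cov0 B X" "q \<in> X" "X \<subseteq> {1..i m - 1} \<union> {i n + 1..N}" for X
      using int[OF that(1,2)] that(3) unfolding I by blast
    have arc: "\<exists>k l. (k, l) \<in> arcs B \<and> q \<in> {k, l} \<and> cyc N k l \<subseteq> cyc N x y - {x, y}"
      if t: "1 \<le> t" "t < m" "q = i t \<or> q = i (2 * ?s + 1 - t)" for t
    proof (intro exI conjI)
      have "(i (2 * ?s + 1 - t), i t) \<in> B0 B" using iD(3)[of t] t m by auto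
      then show "(i (2 * ?s + 1 - t), i t) \<in> arcs B" by (simp add: B0_iff_arcs)
      show "q \<in> {i (2 * ?s + 1 - t), i t}" using t by auto
      have "i t < i m" using t m by (intro iD(1)) auto
      moreover have "i n < i (2 * ?s + 1 - t)" using t m by (intro iD(1)) (auto simp: n_def)
      moreover have "i t < i (2 * ?s + 1 - t)" using t m by (intro iD(1)) auto
      ultimately show "cyc N (i (2 * ?s + 1 - t)) (i t) \<subseteq> cyc N x y - {x, y}"
        unfolding I by (auto simp: cyc_def)
    qed
    have mono_le: "i a \<le> i b" if "1 \<le> a" "a \<le> b" "b \<le> 2 * ?s" for a b
      using iD(1)[of a b] that by (cases "a = b") auto
    have s: "1 \<le> ?s" using m by auto
    from q have "q \<in> {1..i m - 1} \<or> q \<in> {i n + 1..N}" unfolding I by blast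
    then show ?thesis
    proof
      assume q: "q \<in> {1..i m - 1}"
      then have "q < i m" by auto
      from locate_below[of m q i, OF m(1) this] show ?thesis
      proof
        assume "q < i 1"
        then show ?thesis using q out[OF s] mono_le[of 1 m] m n
          by (intro int'[of "{1..i 1 - 1}"]) auto
      next
        assume "\<exists>t. 1 \<le> t \<and> t < m \<and> i t \<le> q \<and> q < i (t + 1)"
        then obtain t where t: "1 \<le> t" "t < m" "i t \<le> q" "q < i (t + 1)" by blast
        show ?thesis
        proof (cases "q = i t")
          case False
          have "cov0 B {i t + 1..i (t + 1) - 1}" using sp t m by (auto simp: spaced_def)
          then show ?thesis using False t mono_le[of "t + 1" m] m
            by (intro int'[of "{i t + 1..i (t + 1) - 1}"]) auto
        qed (use arc t in blast)
      qed
    next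
      assume q: "q \<in> {i n + 1..N}"
      then have "i n < q" by auto
      from locate_above[of n _ i q, OF n(2) this] show ?thesis
      proof
        assume "i (2 * ?s) < q"
        then show ?thesis using q out[OF s] mono_le[of n "2 * ?s"] m n
          by (intro int'[of "{i (2 * ?s) + 1..N}"]) auto
      next
        assume "\<exists>t. n \<le> t \<and> t < 2 * ?s \<and> i t < q \<and> q \<le> i (t + 1)"
        then obtain t where t: "n \<le> t" "t < 2 * ?s" "i t < q" "q \<le> i (t + 1)" by blast
        show ?thesis
        proof (cases "q = i (t + 1)")
          case False
          have "cov0 B {i t + 1..i (t + 1) - 1}" using sp t n by (auto simp: spaced_def)
          moreover have "i (t + 1) \<le> N" using iD(2)[of "t + 1"] t by auto
          ultimately show ?thesis using False t mono_le[of n t] n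
            by (intro int'[of "{i t + 1..i (t + 1) - 1}"]) auto
        next
          case True
          \<comment> \<open>Here q is a right end; the left end of its arc has the reflected index
            \<open>2 * ?s - t\<close>.\<close>
          have "1 \<le> 2 * ?s - t" "2 * ?s - t < m" using t by (auto simp: n_def)
          moreover have "2 * ?s + 1 - (2 * ?s - t) = t + 1" using t by simp
          ultimately show ?thesis using arc True by metis
        qed
      qed
    qed
  qed
  then show ?thesis using B unfolding noncr_def by blast
qed

lemma starPN_iff:
  "B \<in> starPN N \<longleftrightarrow> B \<in> PN N \<and> (\<forall>i j. (i, j) \<in> B1 B \<longrightarrow> cov0 B {i+1..j-1}) \<and> (\<exists>i. seq_ok N B i)"
  by (auto simp: starPN_def)

lemma noncr_seq_ok:
  assumes B: "B \<in> noncr N"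
  shows "B \<in> starPN N"
    and "\<exists>i. seq_ok N B i \<and> (1 \<le> s0 B \<longrightarrow> cov0 B {1..i 1 - 1} \<and> cov0 B {i (2 * s0 B) + 1..N})"
proof -
  have BP: "B \<in> PN N" using B by (simp add: noncr_def)
  obtain i where i: "rainbow N B i" using noncr_ex_rainbow[OF B] ..
  note sp = noncr_rainbow_spaced[OF B i]
  show "\<exists>i. seq_ok N B i \<and> (1 \<le> s0 B \<longrightarrow> cov0 B {1..i 1 - 1} \<and> cov0 B {i (2 * s0 B) + 1..N})"
    using i sp by (auto simp: seq_ok_iff)
  have "cov0 B {i+1..j-1}" if "(i, j) \<in> B1 B" for i j
    using noncr_fully_matched[OF B] that by (intro fully_matched_cov0[OF BP])
  then show "B \<in> starPN N" using BP i sp(1) by (auto simp: starPN_iff seq_ok_iff)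
qed

text \<open>Identifies the covering conditions in \<open>Xminus\<close> with \<open>noncr\<close>,
  so that only the parity condition at N remains to be treated.\<close>

lemma noncr_iff:
  "B \<in> noncr N \<longleftrightarrow> B \<in> starPN N \<and> (s0 B = 0 \<or> (s0 B \<ge> 1 \<and>
     (\<exists>i. seq_ok N B i \<and> cov0 B {1..i 1 - 1} \<and> cov0 B {i (2 * s0 B) + 1..N})))"
proof
  assume "B \<in> noncr N"
  from noncr_seq_ok[OF this]
  show "B \<in> starPN N \<and> (s0 B = 0 \<or> (s0 B \<ge> 1 \<and>
     (\<exists>i. seq_ok N B i \<and> cov0 B {1..i 1 - 1} \<and> cov0 B {i (2 * s0 B) + 1..N})))"
    by (auto simp: Suc_le_eq)
next
  assume "B \<in> starPN N \<and> (s0 B = 0 \<or> (s0 B \<ge> 1 \<and>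
     (\<exists>i. seq_ok N B i \<and> cov0 B {1..i 1 - 1} \<and> cov0 B {i (2 * s0 B) + 1..N})))"
  then obtain i where "B \<in> PN N" "rainbow N B i" "spaced B i"
    "\<And>i j. (i, j) \<in> B1 B \<Longrightarrow> cov0 B {i+1..j-1}"
    "1 \<le> s0 B \<Longrightarrow> cov0 B {1..i 1 - 1} \<and> cov0 B {i (2 * s0 B) + 1..N}"
    unfolding starPN_iff seq_ok_iff by (metis not_one_le_zero)
  then show "B \<in> noncr N" by (rule rainbow_noncr)
qed

subsection \<open>The arc at the last point\<close>

lemma cov0_subfamily:
  assumes "P \<subseteq> B1 B" "Q \<subseteq> P" "X = (\<Union>p\<in>Q. {fst p..snd p})"
    "\<forall>p\<in>P. \<forall>q\<in>P. p \<noteq> q \<longrightarrow> {fst p..snd p} \<inter> {fst q..snd q} = {}"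
  shows "cov0 B X"
proof -
  have "\<forall>p\<in>Q. \<forall>q\<in>Q. p \<noteq> q \<longrightarrow> {fst p..snd p} \<inter> {fst q..snd q} = {}"
    using assms(2,4) by blast
  then show ?thesis unfolding cov0_def using assms(3) subset_trans[OF assms(2,1)]
    by (intro exI[of _ Q] conjI)
qed

text \<open>Each covering interval avoids u and so lies on one side of it; sorting the family by
  side splits the cover. The bound on a keeps \<open>u - 1\<close> from truncating.\<close>

lemma cov1_interval_iff:
  assumes "1 \<le> a"
  shows "cov1 B {a..b} \<longleftrightarrow> (\<exists>u \<in> {a..b}. cov0 B {a..u-1} \<and> cov0 B {u+1..b})"
proof
  assume "cov1 B {a..b}"
  then obtain P u where P: "P \<subseteq> B1 B"
      "\<forall>p\<in>P. \<forall>q\<in>P. p \<noteq> q \<longrightarrow> {fst p..snd p} \<inter> {fst q..snd q} = {}"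
      "u \<notin> (\<Union>p\<in>P. {fst p..snd p})" "{a..b} = (\<Union>p\<in>P. {fst p..snd p}) \<union> {u}"
    unfolding cov1_def by (elim exE conjE) (rule that)
  have u: "u \<in> {a..b}" using P(4) by blast
  have side: "snd p < u \<or> u < fst p" "a \<le> fst p" "snd p \<le> b" if "p \<in> P" for p
  proof -
    have "fst p < snd p" using that P(1) by (cases p) (auto simp: B1_iff_arcs)
    moreover have "u \<notin> {fst p..snd p}" "{fst p..snd p} \<subseteq> {a..b}" using that P(3,4) by auto
    ultimately show "snd p < u \<or> u < fst p" "a \<le> fst p" "snd p \<le> b" by auto
  qed
  have cov: "\<exists>p \<in> P. x \<in> {fst p..snd p}" if "x \<in> {a..b}" "x \<noteq> u" for x
    using P(4) that by blast
  have "{a..u-1} = (\<Union>p\<in>{p \<in> P. snd p < u}. {fst p..snd p})"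
  proof (intro subset_antisym subsetI)
    fix x assume x: "x \<in> {a..u-1}"
    then have "x < u" "x \<in> {a..b}" using assms u by auto
    then obtain p where "p \<in> P" "x \<in> {fst p..snd p}" using cov by blast
    moreover from this have "snd p < u" using side(1)[of p] \<open>x < u\<close> by auto
    ultimately show "x \<in> (\<Union>p\<in>{p \<in> P. snd p < u}. {fst p..snd p})" by blast
  qed (use side(2) in fastforce)
  then have "cov0 B {a..u-1}" by (rule cov0_subfamily[OF P(1) _ _ P(2), rotated]) blast
  moreover have "{u+1..b} = (\<Union>p\<in>{p \<in> P. u < fst p}. {fst p..snd p})"
  proof (intro subset_antisym subsetI)
    fix x assume x: "x \<in> {u+1..b}"
    then have "u < x" "x \<in> {a..b}" using u by auto
    then obtain p where "p \<in> P" "x \<in> {fst p..snd p}" using cov by blast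
    moreover from this have "u < fst p" using side(1)[of p] \<open>u < x\<close> by auto
    ultimately show "x \<in> (\<Union>p\<in>{p \<in> P. u < fst p}. {fst p..snd p})" by blast
  qed (use side(3) in fastforce)
  then have "cov0 B {u+1..b}" by (rule cov0_subfamily[OF P(1) _ _ P(2), rotated]) blast
  ultimately show "\<exists>u \<in> {a..b}. cov0 B {a..u-1} \<and> cov0 B {u+1..b}" using u by blast
next
  assume "\<exists>u \<in> {a..b}. cov0 B {a..u-1} \<and> cov0 B {u+1..b}"
  then obtain u where u: "u \<in> {a..b}" "cov0 B {a..u-1}" "cov0 B {u+1..b}" by blast
  then have "cov0 B ({a..u-1} \<union> {u+1..b})" by (intro cov0_Un) auto
  moreover have "{a..u-1} \<union> {u+1..b} = {a..b} - {u}" using u(1) assms by auto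
  ultimately obtain P where P: "P \<subseteq> B1 B" "{a..b} - {u} = (\<Union>p\<in>P. {fst p..snd p})"
      "\<forall>p\<in>P. \<forall>q\<in>P. p \<noteq> q \<longrightarrow> {fst p..snd p} \<inter> {fst q..snd q} = {}"
    unfolding cov0_def by auto
  show "cov1 B {a..b}" unfolding cov1_def
    using P u(1) by (intro exI[of _ P] exI[of _ u] conjI) blast+
qed

section \<open>The exceptional unmatched point\<close>

text \<open>Cases (i) and (ii) in one predicate with the exceptional point u made explicit, serving
  both \<open>Xplus\<close> and \<open>uB\<close>.\<close>

definition punctured :: "nat \<Rightarrow> nat set set \<Rightarrow> (nat \<Rightarrow> nat) \<Rightarrow> nat \<Rightarrow> bool" where
  "punctured N B i u \<longleftrightarrow> seq_ok N B i \<and>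
     (u \<in> {1..i 1 - 1} \<and> cov0 B {1..u-1} \<and> cov0 B {u+1..i 1 - 1} \<and> cov0 B {i (2 * s0 B) + 1..N-1} \<or>
      u \<in> {i (2 * s0 B) + 1..N-1} \<and> cov0 B {i (2 * s0 B) + 1..u-1} \<and> cov0 B {u+1..N-1} \<and>
        cov0 B {1..i 1 - 1})"

lemma caseI_iff:
  "caseI N B i \<longleftrightarrow> (\<exists>u \<in> {1..i 1 - 1}. cov0 B {1..u-1} \<and> cov0 B {u+1..i 1 - 1}) \<and>
     cov0 B {i (2 * s0 B) + 1..N-1}"
  unfolding caseI_def by (subst cov1_interval_iff) simp_all

lemma caseII_iff:
  "caseII N B i \<longleftrightarrow> cov0 B {1..i 1 - 1} \<and> (\<exists>u \<in> {i (2 * s0 B) + 1..N-1}.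
     cov0 B {i (2 * s0 B) + 1..u-1} \<and> cov0 B {u+1..N-1})"
  unfolding caseII_def by (subst cov1_interval_iff) simp_all

lemma uB_eq_THE: "uB N B = (THE u. \<exists>i. punctured N B i u)"
proof -
  have "(caseI N B i \<and> u \<in> {1..i 1 - 1} \<and> cov0 B {1..u-1} \<and> cov0 B {u+1..i 1 - 1}) \<or>
      (caseII N B i \<and> u \<in> {i (2 * s0 B) + 1..N-1} \<and> cov0 B {i (2 * s0 B) + 1..u-1}
          \<and> cov0 B {u+1..N-1}) \<longleftrightarrow>
      u \<in> {1..i 1 - 1} \<and> cov0 B {1..u-1} \<and> cov0 B {u+1..i 1 - 1} \<and> cov0 B {i (2 * s0 B) + 1..N-1} \<or>
      u \<in> {i (2 * s0 B) + 1..N-1} \<and> cov0 B {i (2 * s0 B) + 1..u-1} \<and> cov0 B {u+1..N-1} \<and>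
        cov0 B {1..i 1 - 1}" for i u
    unfolding caseI_iff caseII_iff by blast
  then show ?thesis unfolding uB_def punctured_def by presburger
qed

lemma ex_punctured_iff:
  "(\<exists>i. seq_ok N B i \<and> (caseI N B i \<or> caseII N B i)) \<longleftrightarrow> (\<exists>i u. punctured N B i u)"
  unfolding punctured_def caseI_iff caseII_iff by blast

lemma Xplus_iff:
  "B \<in> Xplus N \<longleftrightarrow> B \<in> starPN N \<and> N \<notin> supp B \<and>
     (s0 B = 0 \<or> odd (s0 B) \<and> (\<exists>i u. punctured N B i u))"
  unfolding Xplus_def ex_punctured_iff by simp

lemma Xminus_iff:
  "B \<in> Xminus N \<longleftrightarrow> B \<in> noncr N \<and> (\<exists>u. {u, N} \<in> B \<and> (even u \<longleftrightarrow> even (s0 B)))"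
  unfolding Xminus_def noncr_iff by auto

lemma starPN_fully_matched:
  assumes B: "B \<in> starPN N" and X: "cov0 B X"
  shows "fully_matched B X"
  using B by (intro cov0_fully_matched[OF _ X]) (auto simp: starPN_iff)

text \<open>The points before \<open>i 1\<close> together with those after
  \<open>i (2 * s0 B)\<close> and before N, described without the sequence i because
  \<open>uB\<close> ranges over all such sequences.\<close>

definition outside :: "nat \<Rightarrow> nat set set \<Rightarrow> nat set" where
  "outside N B = {x \<in> {1..N-1}. (\<forall>y \<in> ends0 B. x < y) \<or> (\<forall>y \<in> ends0 B. y < x)}"

lemma rainbow_bounds:
  assumes i: "rainbow N B i" and s: "1 \<le> s0 B"
  shows "i 1 \<in> ends0 B" "i (2 * s0 B) \<in> ends0 B" "i 1 < i (2 * s0 B)"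
    "1 \<le> i 1" "i (2 * s0 B) \<le> N" "x \<in> ends0 B \<Longrightarrow> i 1 \<le> x \<and> x \<le> i (2 * s0 B)"
proof -
  show "i 1 \<in> ends0 B" "i (2 * s0 B) \<in> ends0 B" using s unfolding rainbow_ends0[OF i] by auto
  show "i 1 < i (2 * s0 B)" using s by (intro rainbowD(1)[OF i]) auto
  show "1 \<le> i 1" "i (2 * s0 B) \<le> N" using s rainbowD(2)[OF i] by auto
  assume x: "x \<in> ends0 B"
  then obtain k where k: "1 \<le> k" "k \<le> 2 * s0 B" "x = i k" unfolding rainbow_ends0[OF i] by auto
  show "i 1 \<le> x \<and> x \<le> i (2 * s0 B)"
    using rainbowD(1)[OF i, of 1 k] rainbowD(1)[OF i, of k "2 * s0 B"] k
    by (cases "k = 1"; cases "k = 2 * s0 B") auto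
qed

lemma rainbow_outside:
  assumes i: "rainbow N B i" and s: "1 \<le> s0 B"
  shows "outside N B = {1..i 1 - 1} \<union> {i (2 * s0 B) + 1..N-1}"
proof (intro subset_antisym subsetI)
  note b = rainbow_bounds[OF i s]
  fix x
  show "x \<in> outside N B" if "x \<in> {1..i 1 - 1} \<union> {i (2 * s0 B) + 1..N-1}"
    using that b(3-5) b(6) unfolding outside_def by fastforce
  show "x \<in> {1..i 1 - 1} \<union> {i (2 * s0 B) + 1..N-1}" if "x \<in> outside N B"
    using that b(1,2) unfolding outside_def by fastforce
qed

text \<open>Characterizes u independently of i, as the only unmatched point of
  \<open>outside N B\<close>. If u had a partner v, their arc would be in \<open>B1 B\<close>. The
  other outside points are matched on their own side of u, and N is unmatched, so v would lie
  between the extreme ends of \<open>B0\<close> arcs; the arc would then pass over one of these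
  ends, which is impossible.\<close>

lemma punctured_outside:
  assumes B: "B \<in> starPN N" and N: "N \<notin> supp B" and s: "1 \<le> s0 B" and u: "punctured N B i u"
  shows "u \<in> outside N B" "u \<notin> supp B" "outside N B - {u} \<subseteq> supp B"
proof -
  have i: "rainbow N B i" using u by (simp add: punctured_def seq_ok_iff)
  have BP: "B \<in> PN N" using B by (simp add: starPN_iff)
  note b = rainbow_bounds[OF i s] and out = rainbow_outside[OF i s]
  show uo: "u \<in> outside N B" using u unfolding out punctured_def by blast
  have fm: "fully_matched B (outside N B \<inter> {..<u})" "fully_matched B (outside N B \<inter> {u<..})"
  proof -
    have "cov0 B (outside N B \<inter> {..<u}) \<and> cov0 B (outside N B \<inter> {u<..})"
    proof (cases "u < i 1")
      case True
      then have c: "u \<in> {1..i 1 - 1}" "cov0 B {1..u-1}" "cov0 B {u+1..i 1 - 1}" "cov0 B {i (2 * s0 B) + 1..N-1}"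
        using u b(3) unfolding punctured_def by auto
      have o: "outside N B \<inter> {..<u} = {1..u-1}"
        "outside N B \<inter> {u<..} = {u+1..i 1 - 1} \<union> {i (2 * s0 B) + 1..N-1}"
        unfolding out using b(3) c(1) by auto
      have "{u+1..i 1 - 1} \<inter> {i (2 * s0 B) + 1..N-1} = {}" using b(3) by auto
      then show ?thesis unfolding o using c cov0_Un by blast
    next
      case False
      then have c: "u \<in> {i (2 * s0 B) + 1..N-1}" "cov0 B {i (2 * s0 B) + 1..u-1}" "cov0 B {u+1..N-1}"
        "cov0 B {1..i 1 - 1}"
        using u b(3) unfolding punctured_def by auto
      have o: "outside N B \<inter> {u<..} = {u+1..N-1}"
        "outside N B \<inter> {..<u} = {1..i 1 - 1} \<union> {i (2 * s0 B) + 1..u-1}"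
        unfolding out using b(3) c(1) by auto
      have "{1..i 1 - 1} \<inter> {i (2 * s0 B) + 1..u-1} = {}" using b(3) by auto
      then show ?thesis unfolding o using c cov0_Un by blast
    qed
    then show "fully_matched B (outside N B \<inter> {..<u})" "fully_matched B (outside N B \<inter> {u<..})"
      using starPN_fully_matched[OF B] by auto
  qed
  have "outside N B - {u} \<subseteq> (outside N B \<inter> {..<u}) \<union> (outside N B \<inter> {u<..})" by auto
  also have "\<dots> \<subseteq> supp B" using fm fully_matched_subset_supp by blast
  finally show "outside N B - {u} \<subseteq> supp B" .
  show "u \<notin> supp B"
  proof
    assume "u \<in> supp B"
    then obtain X where X: "X \<in> B" "u \<in> X" by (auto simp: supp_def)
    then obtain k l where kl: "u \<in> {k, l}" "(k, l) \<in> arcs B" by (metis PN_pairE[OF BP])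
    have "\<not> (k, l) \<in> B0 B"
    proof
      assume "(k, l) \<in> B0 B"
      then have "u \<in> ends0 B" using kl(1) by (auto simp: ends0_iff)
      then show False using uo by (auto simp: outside_def)
    qed
    then have kl1: "(k, l) \<in> B1 B" using kl(2) arcs_iff_B01 by blast
    define v where "v = (if u = k then l else k)"
    have uv: "{k, l} = {u, v}" using kl(1) by (auto simp: v_def)
    have "v \<noteq> u" using arcs_range(5)[OF BP kl(2)] kl(1) by (auto simp: v_def)
    have notin: "v \<notin> X" if X: "fully_matched B X" "u \<notin> X" for X
    proof
      assume "v \<in> X"
      then obtain k' l' where k': "(k', l') \<in> B1 B" "v \<in> {k', l'}" "{k'..l'} \<subseteq> X"
        by (rule fully_matchedE[OF X(1)])
      have "k = k' \<and> l = l'"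
        using arcs_eq[OF BP kl(2), of k' l'] k'(1,2) uv by (simp add: B1_iff_arcs) blast
      then have "u \<in> {k'..l'}" using kl(1) k'(1) by (auto simp: B1_iff_arcs)
      then show False using k'(3) X(2) by blast
    qed
    have "v \<notin> outside N B" using notin[OF fm(1)] notin[OF fm(2)] \<open>v \<noteq> u\<close> by auto
    moreover have "v \<noteq> N"
      using N kl1 uv by (auto simp: supp_def B1_def)
    moreover have "1 \<le> v" "v \<le> N" using arcs_range[OF BP kl(2)] by (auto simp: v_def)
    ultimately have v: "i 1 \<le> v" "v \<le> i (2 * s0 B)" unfolding out by auto
    have "fully_matched B {k+1..l-1}"
      using B kl1 by (intro starPN_fully_matched[OF B]) (auto simp: starPN_iff)
    note no = ends0_not_inside_B1[OF BP kl1 this]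
    have "k < l" using kl1 by (simp add: B1_iff_arcs)
    have "u < i 1 \<or> i (2 * s0 B) < u" using uo b(1,2) unfolding outside_def by blast
    then have "i 1 \<in> {k..l} \<or> i (2 * s0 B) \<in> {k..l}"
      using v uv \<open>k < l\<close> by (auto simp: doubleton_eq_iff)
    then show False using no b(1,2) by blast
  qed
qed

lemma uB_punctured:
  assumes B: "B \<in> starPN N" and N: "N \<notin> supp B" and s: "1 \<le> s0 B" and u: "punctured N B i u"
  shows "uB N B = u"
  unfolding uB_eq_THE
proof (rule the_equality)
  fix v assume "\<exists>i. punctured N B i v"
  then obtain j where "punctured N B j v" ..
  from punctured_outside[OF B N s this] punctured_outside[OF B N s u] show "v = u" by blast
qed (use u in blast)

section \<open>Inserting and removing an arc at the last point\<close>

lemma PN_insert: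
  assumes B: "B \<in> PN N" and "a \<in> {1..N}" "b \<in> {1..N}" "a \<noteq> b" "a \<notin> supp B" "b \<notin> supp B"
  shows "insert {a, b} B \<in> PN N"
  using assms unfolding PN_def supp_def by auto

lemma arcs_insert:
  assumes "a < b"
  shows "arcs (insert {a, b} B) = insert (if odd (a + b) then (a, b) else (b, a)) (arcs B)"
  using assms by (auto simp: arcs_def doubleton_eq_iff add.commute)

lemma B1_insert:
  assumes "a < b"
  shows "B1 (insert {a, b} B) = (if odd (a + b) then insert (a, b) (B1 B) else B1 B)"
  using arcs_insert[OF assms, of B] assms by (auto simp: B1_iff_arcs)

lemma B0_insert:
  assumes "a < b"
  shows "B0 (insert {a, b} B) = (if odd (a + b) then B0 B else insert (b, a) (B0 B))"
  using arcs_insert[OF assms, of B] assms by (auto simp: B0_iff_arcs)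

lemma cov0_cong: "B1 B = B1 C \<Longrightarrow> cov0 B X = cov0 C X"
  by (simp add: cov0_def)

lemma s0_insert:
  assumes "B \<in> PN N" "a < b" "b \<notin> supp B"
  shows "s0 (insert {a, b} B) = (if odd (a + b) then s0 B else Suc (s0 B))"
proof -
  have "(b, a) \<notin> B0 B" using assms(3) by (auto simp: supp_def B0_def)
  then show ?thesis using B0_insert[OF assms(2), of B] B0_finite[OF assms(1)] by (simp add: s0_def)
qed


lemma rainbowI:
  assumes "\<And>k l. 1 \<le> k \<Longrightarrow> k < l \<Longrightarrow> l \<le> 2 * s0 B \<Longrightarrow> i k < i l"
    and "\<And>k. 1 \<le> k \<Longrightarrow> k \<le> 2 * s0 B \<Longrightarrow> 1 \<le> i k \<and> i k \<le> N"
    and "\<And>k. 1 \<le> k \<Longrightarrow> k \<le> s0 B \<Longrightarrow> (i (2 * s0 B + 1 - k), i k) \<in> B0 B"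
    and "\<And>x y. (x, y) \<in> B0 B \<Longrightarrow> \<exists>k. 1 \<le> k \<and> k \<le> s0 B \<and> x = i (2 * s0 B + 1 - k) \<and> y = i k"
  shows "rainbow N B i"
  unfolding rainbow_def
proof (intro conjI)
  show "strict_mono_on {1..2 * s0 B} i" using assms(1) by (intro strict_mono_onI) auto
  show "\<forall>k \<in> {1..2 * s0 B}. i k \<in> {1..N}" using assms(2) by auto
  show "B0 B = {(i (2 * s0 B + 1 - k), i k) | k. k \<in> {1..s0 B}}"
  proof (intro subset_antisym subsetI)
    fix p assume "p \<in> B0 B"
    then show "p \<in> {(i (2 * s0 B + 1 - k), i k) | k. k \<in> {1..s0 B}}"
      using assms(4) by (cases p) force
  qed (use assms(3) in auto)
qed

lemma spacedD: "spaced B i \<Longrightarrow> 1 \<le> k \<Longrightarrow> k < 2 * s0 B \<Longrightarrow> k \<noteq> s0 B \<Longrightarrow> cov0 B {i k + 1..i (k+1) - 1}"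
  unfolding spaced_def by auto

text \<open>Since \<open>{1..u-1}\<close> is covered, u is odd and the new arc has even difference.
  It supplies the first and last terms of the new sequence u, \<open>i 1\<close>, ...,
  \<open>i (2 * s0 B)\<close>, N.\<close>

lemma insert_noncr_left:
  assumes N: "odd N" and B: "B \<in> starPN N" and NB: "N \<notin> supp B" and s: "odd (s0 B)"
    and i: "seq_ok N B i" and u: "u \<in> {1..i 1 - 1}" "u \<notin> supp B" "u < N"
    and c: "cov0 B {1..u-1}" "cov0 B {u+1..i 1 - 1}" "cov0 B {i (2 * s0 B) + 1..N-1}"
  shows "insert {u, N} B \<in> noncr N" "odd u" "s0 (insert {u, N} B) = Suc (s0 B)"
proof -
  let ?C = "insert {u, N} B" and ?s = "s0 B"
  have BP: "B \<in> PN N" using B by (simp add: starPN_iff)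
  have CP: "?C \<in> PN N" using u NB by (intro PN_insert[OF BP]) auto
  show ou: "odd u" using cov0_even[OF BP c(1)] u(1) by (auto simp: even_diff_nat)
  then have e: "even (u + N)" using N by simp
  show sC: "s0 ?C = Suc ?s" using s0_insert[OF BP u(3) NB] e by simp
  have B1C: "B1 ?C = B1 B" using B1_insert[OF u(3), of B] e by simp
  then have cC: "cov0 ?C X = cov0 B X" for X by (rule cov0_cong)
  have B0C: "B0 ?C = insert (N, u) (B0 B)" using B0_insert[OF u(3), of B] e by simp
  have s1: "1 \<le> ?s" using s by (cases ?s) auto
  have r: "rainbow N B i" and sp: "spaced B i" using i by (auto simp: seq_ok_iff)
  note iD = rainbowD[OF r]
  define j where "j k = (if k = 1 then u else if k = 2 * ?s + 2 then N else i (k - 1))" for k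
  have jk: "j k = i (k - 1)" if "2 \<le> k" "k \<le> 2 * ?s + 1" for k
    using that by (auto simp: j_def)
  have j1: "j 1 = u" and jN: "j (2 * ?s + 2) = N" by (auto simp: j_def)
  have ui: "u < i k" if "1 \<le> k" "k \<le> 2 * ?s" for k
    using u(1) iD(1)[of 1 k] that by (cases "k = 1") auto
  have iN: "i k < N" if k: "1 \<le> k" "k \<le> 2 * ?s" for k
  proof -
    have "i k \<in> ends0 B" unfolding rainbow_ends0[OF r] using k by auto
    then have "i k \<noteq> N" using NB by (auto simp: ends0_iff B0_def supp_def)
    then show ?thesis using iD(2)[OF k] by simp
  qed
  have rj: "rainbow N ?C j"
  proof (rule rainbowI, unfold sC)
    fix k l assume kl: "1 \<le> k" "k < l" "l \<le> 2 * Suc ?s"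
    have "l = 2 * ?s + 2 \<or> l < 2 * ?s + 2" using kl(3) by auto
    then consider "k = 1" "l = 2 * ?s + 2" | "k = 1" "l < 2 * ?s + 2" | "k \<noteq> 1" "l = 2 * ?s + 2"
      | "k \<noteq> 1" "l < 2 * ?s + 2" by blast
    then show "j k < j l"
    proof cases
      case 1
      then show ?thesis using j1 jN u(3) by simp
    next
      case 2
      then show ?thesis using j1 jk[of l] ui[of "l - 1"] kl by auto
    next
      case 3
      then show ?thesis using jN jk[of k] iN[of "k - 1"] kl by auto
    next
      case 4
      then show ?thesis using jk[of k] jk[of l] iD(1)[of "k - 1" "l - 1"] kl by auto
    qed
  next
    fix k assume "1 \<le> k" "k \<le> 2 * Suc ?s"
    then show "1 \<le> j k \<and> j k \<le> N" using u iD(2)[of "k - 1"] by (auto simp: j_def)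
  next
    fix k assume k: "1 \<le> k" "k \<le> Suc ?s"
    show "(j (2 * Suc ?s + 1 - k), j k) \<in> B0 ?C"
    proof (cases "k = 1")
      case True
      then show ?thesis using j1 jN unfolding B0C by simp
    next
      case False
      then have "j (2 * Suc ?s + 1 - k) = i (2 * ?s + 1 - (k - 1))" "j k = i (k - 1)"
        using k by (subst jk; auto intro!: arg_cong[of _ _ i])+
      then show ?thesis unfolding B0C using iD(3)[of "k - 1"] k False by auto
    qed
  next
    fix x y assume "(x, y) \<in> B0 ?C"
    then consider "x = N" "y = u" | "(x, y) \<in> B0 B" unfolding B0C by auto
    then show "\<exists>k. 1 \<le> k \<and> k \<le> Suc ?s \<and> x = j (2 * Suc ?s + 1 - k) \<and> y = j k"
    proof cases
      case 1
      then show ?thesis using j1 jN by (intro exI[of _ 1]) simp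
    next
      case 2
      then obtain k where k: "1 \<le> k" "k \<le> ?s" "x = i (2 * ?s + 1 - k)" "y = i k" using iD(4) by blast
      then have "j (2 * Suc ?s + 1 - (k + 1)) = i (2 * ?s + 1 - k)" "j (k + 1) = i k"
        by (subst jk; auto intro!: arg_cong[of _ _ i])+
      then show ?thesis using k by (intro exI[of _ "k + 1"]) auto
    qed
  qed
  have "spaced ?C j" unfolding spaced_def sC
  proof (intro ballI impI)
    fix k assume k: "k \<in> {1..<2 * Suc ?s}" "k \<noteq> Suc ?s"
    consider "k = 1" | "2 \<le> k" "k < 2 * ?s + 1" | "k = 2 * ?s + 1" using k(1) by fastforce
    then have "cov0 B {j k + 1..j (k+1) - 1}"
    proof cases
      case 1
      then show ?thesis using c(2) j1 jk[of 2] s1 by (simp add: numeral_2_eq_2)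
    next
      case 2
      then have "cov0 B {i (k - 1) + 1..i (k - 1 + 1) - 1}" using sp k by (intro spacedD) auto
      then show ?thesis using 2 jk[of k] jk[of "k + 1"] by simp
    next
      case 3
      then show ?thesis using c(3) jN jk[of k] s1 by simp
    qed
    then show "cov0 ?C {j k + 1..j (k+1) - 1}" by (simp add: cC)
  qed
  moreover have "cov0 ?C {a+1..b-1}" if "(a, b) \<in> B1 ?C" for a b
    using that B unfolding cC B1C by (auto simp: starPN_iff)
  moreover have "cov0 ?C {1..j 1 - 1} \<and> cov0 ?C {j (2 * s0 ?C) + 1..N}"
    unfolding sC cC j1 using c(1) jN cov0_empty by simp
  ultimately show "?C \<in> noncr N" by (intro rainbow_noncr[OF CP rj])
qed

text \<open>Since \<open>{u+1..N-1}\<close> is covered, u is even and the new arc has odd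
  difference. The sequence stays the same, and the new arc extends the cover of the last stretch up
  to N.\<close>

lemma insert_noncr_right:
  assumes N: "odd N" and B: "B \<in> starPN N" and NB: "N \<notin> supp B" and s: "odd (s0 B)"
    and i: "seq_ok N B i" and u: "u \<in> {i (2 * s0 B) + 1..N-1}" "u \<notin> supp B" "u < N"
    and c: "cov0 B {i (2 * s0 B) + 1..u-1}" "cov0 B {u+1..N-1}" "cov0 B {1..i 1 - 1}"
  shows "insert {u, N} B \<in> noncr N" "even u" "s0 (insert {u, N} B) = s0 B"
proof -
  let ?C = "insert {u, N} B" and ?s = "s0 B"
  have BP: "B \<in> PN N" using B by (simp add: starPN_iff)
  have CP: "?C \<in> PN N" using u NB by (intro PN_insert[OF BP]) auto
  have "even (N - 1 - u)" using cov0_even[OF BP c(2)] by simp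
  then show eu: "even u" using u(3) N by (auto simp: even_diff_nat)
  then have o: "odd (u + N)" using N by simp
  show sC: "s0 ?C = ?s" using s0_insert[OF BP u(3) NB] o by simp
  have B1C: "B1 ?C = insert (u, N) (B1 B)" using B1_insert[OF u(3), of B] o by simp
  then have cC: "cov0 ?C X" if "cov0 B X" for X using cov0_mono[OF that] by auto
  have B0C: "B0 ?C = B0 B" using B0_insert[OF u(3), of B] o by simp
  have r: "rainbow N B i" and sp: "spaced B i" using i by (auto simp: seq_ok_iff)
  have "rainbow N ?C i" using r unfolding rainbow_def B0C sC .
  moreover have "spaced ?C i" using sp cC unfolding spaced_def sC by blast
  moreover have "cov0 ?C {a+1..b-1}" if "(a, b) \<in> B1 ?C" for a b
    using that B c(2) cC unfolding B1C by (auto simp: starPN_iff)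
  moreover have "cov0 ?C {i (2 * ?s) + 1..N}"
  proof -
    have "cov0 ?C {u..N}" by (rule cov0_arc) (simp add: B1C)
    then have "cov0 ?C ({i (2 * ?s) + 1..u-1} \<union> {u..N})" using cC[OF c(1)] by (intro cov0_Un) auto
    moreover have "{i (2 * ?s) + 1..u-1} \<union> {u..N} = {i (2 * ?s) + 1..N}" using u by auto
    ultimately show ?thesis by simp
  qed
  ultimately show "?C \<in> noncr N"
    using cC[OF c(3)] by (intro rainbow_noncr[OF CP]) (auto simp: sC)
qed

text \<open>The parity of u disagrees with that of the new number of \<open>B0\<close> arcs. By this
  mark \<open>cut\<close> recognizes an inserted arc.\<close>

lemma insert_punctured:
  assumes N: "odd N" and B: "B \<in> starPN N" and NB: "N \<notin> supp B" and s: "odd (s0 B)"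
    and u: "punctured N B i u"
  shows "insert {u, N} B \<in> noncr N" "even u \<longleftrightarrow> odd (s0 (insert {u, N} B))" "u < N"
proof -
  have s1: "1 \<le> s0 B" using s by (cases "s0 B") auto
  have uo: "u \<in> outside N B" "u \<notin> supp B" using punctured_outside[OF B NB s1 u] by auto
  then show uN: "u < N" by (auto simp: outside_def)
  have i: "seq_ok N B i" using u by (simp add: punctured_def)
  have "insert {u, N} B \<in> noncr N \<and> (even u \<longleftrightarrow> odd (s0 (insert {u, N} B)))"
    using u unfolding punctured_def
  proof (elim conjE disjE)
    assume "u \<in> {1..i 1 - 1}" "cov0 B {1..u-1}" "cov0 B {u+1..i 1 - 1}" "cov0 B {i (2 * s0 B) + 1..N-1}"
    from insert_noncr_left[OF N B NB s i this(1) uo(2) uN this(2-4)] show ?thesis using s by simp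
  next
    assume "u \<in> {i (2 * s0 B) + 1..N-1}" "cov0 B {i (2 * s0 B) + 1..u-1}" "cov0 B {u+1..N-1}"
      "cov0 B {1..i 1 - 1}"
    from insert_noncr_right[OF N B NB s i this(1) uo(2) uN this(2-4)] show ?thesis using s by simp
  qed
  then show "insert {u, N} B \<in> noncr N" "even u \<longleftrightarrow> odd (s0 (insert {u, N} B))" by auto
qed

text \<open>Reverses \<open>insert_noncr_left\<close>. As N is the largest point, its arc supplies
  the first and last terms of the sequence; dropping them shifts the indices by one.\<close>

lemma remove_arc_left:
  assumes N: "odd N" and C: "insert {u, N} B \<in> noncr N" and NB: "N \<notin> supp B" and u: "u < N"
    and ou: "odd u" and s: "even (s0 (insert {u, N} B))" and BP: "B \<in> PN N"
  shows "B \<in> starPN N" "odd (s0 B)" "\<exists>i. punctured N B i u"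
proof -
  let ?C = "insert {u, N} B" and ?s = "s0 B"
  have e: "even (u + N)" using N ou by simp
  have sC: "s0 ?C = Suc ?s" using s0_insert[OF BP u NB] e by simp
  then show os: "odd ?s" using s by simp
  then have s1: "1 \<le> ?s" by (cases ?s) auto
  have B1C: "B1 ?C = B1 B" using B1_insert[OF u, of B] e by simp
  then have cC: "cov0 ?C X = cov0 B X" for X by (rule cov0_cong)
  have B0C: "B0 ?C = insert (N, u) (B0 B)" using B0_insert[OF u, of B] e by simp
  obtain j where j: "rainbow N ?C j" "spaced ?C j"
    "cov0 B {1..j 1 - 1}" "cov0 B {j (2 * Suc ?s) + 1..N}"
    using noncr_seq_ok(2)[OF C] sC unfolding seq_ok_iff cC by auto
  note jD = rainbowD[OF j(1), unfolded sC]
  obtain m where m: "1 \<le> m" "m \<le> Suc ?s" "N = j (2 * Suc ?s + 1 - m)" "u = j m"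
    using jD(4)[of N u] B0C by auto
  have "m = 1"
  proof (rule ccontr)
    assume "m \<noteq> 1"
    then have "N < j (2 * Suc ?s)" using m(1,2) unfolding m(3) by (intro jD(1)) auto
    then show False using jD(2)[of "2 * Suc ?s"] by auto
  qed
  then have ju: "j 1 = u" and jN: "j (2 * Suc ?s) = N" using m by auto
  define i where "i k = j (k + 1)" for k
  have r: "rainbow N B i"
  proof (rule rainbowI)
    fix k l assume "1 \<le> k" "k < l" "l \<le> 2 * ?s"
    then show "i k < i l" unfolding i_def by (intro jD(1)) auto
  next
    fix k assume "1 \<le> k" "k \<le> 2 * ?s"
    then show "1 \<le> i k \<and> i k \<le> N" unfolding i_def by (intro jD(2)) auto
  next
    fix k assume k: "1 \<le> k" "k \<le> ?s"
    then have "(j (2 * Suc ?s + 1 - (k + 1)), j (k + 1)) \<in> B0 ?C" by (intro jD(3)) auto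
    moreover have "2 * Suc ?s + 1 - (k + 1) = 2 * ?s + 1 - k + 1" using k by auto
    moreover have "j 1 < j (k + 1)" using k by (intro jD(1)) auto
    ultimately show "(i (2 * ?s + 1 - k), i k) \<in> B0 B" unfolding B0C i_def using ju by auto
  next
    fix x y assume xy: "(x, y) \<in> B0 B"
    then obtain k where k: "1 \<le> k" "k \<le> Suc ?s" "x = j (2 * Suc ?s + 1 - k)" "y = j k"
      using jD(4)[of x y] B0C by auto
    have "x \<noteq> N" using xy NB by (auto simp: B0_def supp_def)
    then have "k \<noteq> 1" using k(3) jN by auto
    moreover have "2 * Suc ?s + 1 - k = 2 * ?s + 1 - (k - 1) + 1" using k(1,2) \<open>k \<noteq> 1\<close> by auto
    ultimately show "\<exists>k. 1 \<le> k \<and> k \<le> ?s \<and> x = i (2 * ?s + 1 - k) \<and> y = i k"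
      unfolding i_def using k by (intro exI[of _ "k - 1"]) auto
  qed
  have "spaced B i" unfolding spaced_def
  proof (intro ballI impI)
    fix k assume "k \<in> {1..<2 * ?s}" "k \<noteq> ?s"
    then have "cov0 ?C {j (k + 1) + 1..j (k + 1 + 1) - 1}" by (intro spacedD[OF j(2)]) (auto simp: sC)
    then show "cov0 B {i k + 1..i (k+1) - 1}" by (simp add: cC i_def)
  qed
  then have i: "seq_ok N B i" using r by (simp add: seq_ok_iff)
  have "cov0 B {a+1..b-1}" if "(a, b) \<in> B1 B" for a b
    using noncr_seq_ok(1)[OF C] that unfolding starPN_iff B1C cC by blast
  then show "B \<in> starPN N" using BP i by (auto simp: starPN_iff)
  \<comment> \<open>The stretches next to the two dropped terms become the cover right of u and the
    cover ending at N - 1.\<close>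
  have "cov0 B {j 1 + 1..j (1 + 1) - 1}"
    using spacedD[OF j(2), of 1] s1 by (simp add: sC cC)
  moreover have "cov0 B {j (2 * ?s + 1) + 1..j (2 * ?s + 1 + 1) - 1}"
    using spacedD[OF j(2), of "2 * ?s + 1"] s1 by (simp add: sC cC)
  moreover have "j 1 < j 2" using s1 by (intro jD(1)) auto
  moreover have "1 \<le> u" using arcs_range(3)[of ?C N N u] C B0C by (auto simp: noncr_def arcs_iff_B01)
  ultimately have "punctured N B i u"
    unfolding punctured_def using i j(3) ju jN by (auto simp: i_def numeral_2_eq_2)
  then show "\<exists>i. punctured N B i u" by blast
qed

text \<open>Covers of sets avoiding N do not use the removed arc and survive. In the cover of the
  last stretch the removed arc is the interval containing N, and deleting it leaves a cover up to u
  - 1.\<close>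

lemma remove_arc_right:
  assumes N: "odd N" and C: "insert {u, N} B \<in> noncr N" and NB: "N \<notin> supp B" and u: "u < N"
    and eu: "even u" and s: "odd (s0 (insert {u, N} B))" and BP: "B \<in> PN N"
  shows "B \<in> starPN N" "odd (s0 B)" "\<exists>i. punctured N B i u"
proof -
  let ?C = "insert {u, N} B" and ?s = "s0 B"
  have o: "odd (u + N)" using N eu by simp
  have sC: "s0 ?C = ?s" using s0_insert[OF BP u NB] o by simp
  then show os: "odd ?s" using s by simp
  then have s1: "1 \<le> ?s" by (cases ?s) auto
  have CP: "?C \<in> PN N" using C by (simp add: noncr_def)
  have B1C: "B1 ?C = insert (u, N) (B1 B)" using B1_insert[OF u, of B] o by simp
  have B0C: "B0 ?C = B0 B" using B0_insert[OF u, of B] o by simp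
  have cC: "cov0 B X" if X: "cov0 ?C X" "N \<notin> X" for X
  proof -
    obtain P where P: "P \<subseteq> B1 ?C" "X = (\<Union>p\<in>P. {fst p..snd p})"
      "\<forall>p\<in>P. \<forall>q\<in>P. p \<noteq> q \<longrightarrow> {fst p..snd p} \<inter> {fst q..snd q} = {}"
      using X(1) unfolding cov0_def by blast
    have "(u, N) \<notin> P" using P(2) X(2) u by force
    then have "P \<subseteq> B1 B" using P(1) unfolding B1C by blast
    then show ?thesis by (rule cov0_subfamily[OF _ order_refl P(2,3)])
  qed
  obtain i where i: "rainbow N ?C i" "spaced ?C i"
    "cov0 ?C {1..i 1 - 1}" "cov0 ?C {i (2 * ?s) + 1..N}"
    using noncr_seq_ok(2)[OF C] sC s1 unfolding seq_ok_iff by auto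
  have r: "rainbow N B i" using i(1) unfolding rainbow_def B0C sC .
  note iD = rainbowD[OF r]
  have iN: "i k \<le> N" "1 \<le> i k" if "1 \<le> k" "k \<le> 2 * ?s" for k using iD(2)[OF that] by auto
  have "spaced B i" unfolding spaced_def
  proof (intro ballI impI)
    fix k assume k: "k \<in> {1..<2 * ?s}" "k \<noteq> ?s"
    then have "cov0 ?C {i k + 1..i (k + 1) - 1}" by (intro spacedD[OF i(2)]) (auto simp: sC)
    moreover have "N \<notin> {i k + 1..i (k + 1) - 1}" using iN[of "k + 1"] k by auto
    ultimately show "cov0 B {i k + 1..i (k + 1) - 1}" by (rule cC)
  qed
  then have sq: "seq_ok N B i" using r by (simp add: seq_ok_iff)
  have S: "cov0 ?C {a+1..b-1}" if "(a, b) \<in> B1 ?C" for a b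
    using noncr_seq_ok(1)[OF C] that unfolding starPN_iff by blast
  have "cov0 B {a+1..b-1}" if ab: "(a, b) \<in> B1 B" for a b
  proof (rule cC)
    show "cov0 ?C {a+1..b-1}" using ab B1C by (intro S) simp
    have "b \<le> N" using ab arcs_range[OF BP] by (auto simp: B1_iff_arcs)
    then show "N \<notin> {a+1..b-1}" using u by auto
  qed
  then show "B \<in> starPN N" using BP sq by (auto simp: starPN_iff)
  have "(u, N) \<in> B1 ?C" by (simp add: B1C)
  then have cu: "cov0 B {u+1..N-1}" using S by (intro cC) (use u in auto)
  have c1: "cov0 B {1..i 1 - 1}" using i(3) iN[of 1] s1 u by (intro cC) auto
  have bN: "i (2 * ?s) < N"
  proof -
    have "i (2 * ?s) \<in> ends0 B" using rainbow_bounds(2)[OF r s1] .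
    then have "i (2 * ?s) \<noteq> N" using NB by (auto simp: ends0_iff B0_def supp_def)
    then show ?thesis using iN[of "2 * ?s"] s1 by auto
  qed
  obtain P where P: "P \<subseteq> B1 ?C" "{i (2 * ?s) + 1..N} = (\<Union>p\<in>P. {fst p..snd p})"
    "\<forall>p\<in>P. \<forall>q\<in>P. p \<noteq> q \<longrightarrow> {fst p..snd p} \<inter> {fst q..snd q} = {}"
    using i(4) unfolding cov0_def by blast
  have "N \<in> (\<Union>p\<in>P. {fst p..snd p})" using bN unfolding P(2)[symmetric] by simp
  then obtain a b where ab: "(a, b) \<in> P" "a \<le> N" "N \<le> b" by auto
  then have ab1: "(a, b) \<in> B1 ?C" using P(1) by blast
  then have "b = N" using arcs_range(4)[OF CP, of a b] ab by (auto simp: B1_iff_arcs)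
  then have "(a, b) \<notin> B1 B" using NB by (auto simp: B1_def supp_def)
  then have uP: "(u, N) \<in> P" using ab(1) ab1 B1C \<open>b = N\<close> by auto
  then have "{u..N} \<subseteq> {i (2 * ?s) + 1..N}" unfolding P(2) by force
  then have bu: "i (2 * ?s) < u" using u by auto
  have "{i (2 * ?s) + 1..u-1} = (\<Union>p\<in>P - {(u, N)}. {fst p..snd p})"
  proof -
    have "(\<Union>p\<in>P - {(u, N)}. {fst p..snd p}) \<inter> {u..N} = {}" using P(3) uP by fastforce
    moreover have "(\<Union>p\<in>P. {fst p..snd p}) = (\<Union>p\<in>P - {(u, N)}. {fst p..snd p}) \<union> {u..N}"
      using uP by force
    ultimately have "(\<Union>p\<in>P - {(u, N)}. {fst p..snd p}) = {i (2 * ?s) + 1..N} - {u..N}"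
      unfolding P(2) by blast
    also have "\<dots> = {i (2 * ?s) + 1..u-1}" using u by auto
    finally show ?thesis ..
  qed
  moreover have "P - {(u, N)} \<subseteq> B1 B" using P(1) unfolding B1C by blast
  moreover have "\<forall>p\<in>P - {(u, N)}. \<forall>q\<in>P - {(u, N)}. p \<noteq> q \<longrightarrow> {fst p..snd p} \<inter> {fst q..snd q} = {}"
    using P(3) by blast
  ultimately have "cov0 B {i (2 * ?s) + 1..u-1}" by (intro cov0_subfamily[OF _ order_refl])
  then have "punctured N B i u" unfolding punctured_def using sq cu c1 bu u by auto
  then show "\<exists>i. punctured N B i u" by blast
qed

section \<open>The domain and the non-crossing matchings\<close>

text \<open>The case distinction is that of \<open>eps'\<close>, with the correction term turned
  into an arc.\<close>

definition close_up :: "nat \<Rightarrow> nat set set \<Rightarrow> nat set set" where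
  "close_up N B = (if B \<in> Xminus N \<or> s0 B = 0 then B else insert {uB N B, N} B)"

text \<open>In \<open>Xminus\<close> the parities of u and \<open>s0 B\<close> agree, so an arc at N
  that belongs to the original matching is kept.\<close>

definition cut :: "nat \<Rightarrow> nat set set \<Rightarrow> nat set set" where
  "cut N B = (if \<exists>u. {u, N} \<in> B \<and> (even u \<longleftrightarrow> odd (s0 B)) then {X \<in> B. N \<notin> X} else B)"

lemma Xminus_supp: "B \<in> Xminus N \<Longrightarrow> N \<in> supp B"
  by (auto simp: Xminus_iff supp_def)

lemma Xplus_odd:
  assumes N: "odd N" and B: "B \<in> Xplus N" and s: "s0 B \<noteq> 0"
  shows "close_up N B = insert {uB N B, N} B" "insert {uB N B, N} B \<in> noncr N"
    "even (uB N B) \<longleftrightarrow> odd (s0 (insert {uB N B, N} B))" "uB N B < N"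
proof -
  have NB: "N \<notin> supp B" and BS: "B \<in> starPN N" and so: "odd (s0 B)"
    using B s by (auto simp: Xplus_iff)
  obtain i u where u: "punctured N B i u" using B s by (auto simp: Xplus_iff)
  have "uB N B = u" using uB_punctured[OF BS NB _ u] s by simp
  then show "insert {uB N B, N} B \<in> noncr N"
    "even (uB N B) \<longleftrightarrow> odd (s0 (insert {uB N B, N} B))" "uB N B < N"
    using insert_punctured[OF N BS NB so u] by auto
  show "close_up N B = insert {uB N B, N} B"
    using NB Xminus_supp s by (auto simp: close_up_def)
qed

text \<open>Members of \<open>noncr\<close> fall into three kinds: a parity mismatch at N marks an
  inserted arc, a match means membership in \<open>Xminus\<close>, and if N is unmatched there are
  no \<open>B0\<close> arcs and the matching is in \<open>Xplus\<close>.\<close>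

lemma close_up_bij:
  assumes N: "odd N"
  shows "bij_betw (close_up N) (XN N) (noncr N)"
proof (rule bij_betw_byWitness[where f' = "cut N"])
  have pair_eq: "u = v" if "B \<in> noncr N" "{u, N} \<in> B" "{v, N} \<in> B" for B u v
  proof -
    have "{u, N} = {v, N}" using PN_pair_eq[of B N "{u, N}" "{v, N}" N] that by (auto simp: noncr_def)
    then show ?thesis by (auto simp: doubleton_eq_iff)
  qed
  show "\<forall>B \<in> XN N. cut N (close_up N B) = B"
  proof
    fix B assume "B \<in> XN N"
    then consider "B \<in> Xminus N" | "B \<in> Xplus N" "s0 B = 0" | "B \<in> Xplus N" "s0 B \<noteq> 0"
      unfolding XN_def by auto
    then show "cut N (close_up N B) = B"
    proof cases
      case 1
      then obtain u where "B \<in> noncr N" "{u, N} \<in> B" "even u \<longleftrightarrow> even (s0 B)"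
        by (auto simp: Xminus_iff)
      then have "\<nexists>v. {v, N} \<in> B \<and> (even v \<longleftrightarrow> odd (s0 B))" using pair_eq by blast
      then have "cut N B = B" unfolding cut_def by (simp only: if_False)
      then show ?thesis using 1 by (simp add: close_up_def)
    next
      case 2
      then have "N \<notin> supp B" by (simp add: Xplus_iff)
      then have "\<nexists>v. {v, N} \<in> B" by (auto simp: supp_def)
      then show ?thesis using 2 by (auto simp: close_up_def cut_def)
    next
      case 3
      have "N \<notin> supp B" using 3 by (simp add: Xplus_iff)
      then have "{X \<in> insert {uB N B, N} B. N \<notin> X} = B" by (auto simp: supp_def)
      moreover have "\<exists>u. {u, N} \<in> insert {uB N B, N} B \<and>
          (even u \<longleftrightarrow> odd (s0 (insert {uB N B, N} B)))"
        using Xplus_odd(3)[OF N 3] by (intro exI[of _ "uB N B"]) simp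
      ultimately show ?thesis unfolding Xplus_odd(1)[OF N 3] cut_def by simp
    qed
  qed
  show "close_up N ` XN N \<subseteq> noncr N"
  proof
    fix C assume "C \<in> close_up N ` XN N"
    then obtain B where B: "B \<in> XN N" "C = close_up N B" by blast
    then consider "B \<in> Xminus N" | "B \<in> Xplus N" "s0 B = 0" | "B \<in> Xplus N" "s0 B \<noteq> 0"
      unfolding XN_def by auto
    then show "C \<in> noncr N"
    proof cases
      case 3
      then show ?thesis using Xplus_odd[OF N 3] B by simp
    qed (use B in \<open>auto simp: close_up_def Xminus_iff Xplus_iff noncr_iff\<close>)
  qed
  have key: "cut N C \<in> XN N \<and> close_up N (cut N C) = C" if C: "C \<in> noncr N" for C
  proof -
    have CP: "C \<in> PN N" using C by (simp add: noncr_def)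
    consider (mismatch) u where "{u, N} \<in> C" "even u \<longleftrightarrow> odd (s0 C)"
      | (match) u where "\<nexists>u. {u, N} \<in> C \<and> (even u \<longleftrightarrow> odd (s0 C))" "{u, N} \<in> C"
      | (free) "\<nexists>u. {u, N} \<in> C" by blast
    then show ?thesis
    proof cases
      case mismatch
      define B where "B = {X \<in> C. N \<notin> X}"
      have cut: "cut N C = B" using mismatch by (auto simp: cut_def B_def)
      have CB: "C = insert {u, N} B"
      proof -
        have "X \<in> C \<longleftrightarrow> X = {u, N} \<or> X \<in> C \<and> N \<notin> X" for X
          using PN_pair_eq[OF CP _ mismatch(1), of X N] mismatch(1) by blast
        then show ?thesis unfolding B_def by (intro set_eqI) simp
      qed
      have BP: "B \<in> PN N" using CP by (auto simp: PN_def B_def)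
      have NB: "N \<notin> supp B" by (auto simp: supp_def B_def)
      have "u \<in> {1..N}" "u \<noteq> N" using CP mismatch(1) unfolding PN_def by fastforce+
      then have uN: "u < N" by auto
      have "B \<in> starPN N \<and> odd (s0 B) \<and> (\<exists>i. punctured N B i u)"
      proof (cases "odd u")
        case True
        then have "even (s0 (insert {u, N} B))" using mismatch(2) CB by simp
        from remove_arc_left[OF N C[unfolded CB] NB uN True this BP] show ?thesis by blast
      next
        case False
        then have e: "even u" by simp
        then have "odd (s0 (insert {u, N} B))" using mismatch(2) CB by simp
        from remove_arc_right[OF N C[unfolded CB] NB uN e this BP] show ?thesis by blast
      qed
      then obtain i where B: "B \<in> starPN N" "odd (s0 B)" "punctured N B i u" by blast
      then have X: "B \<in> Xplus N" using NB by (auto simp: Xplus_iff)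
      have s: "s0 B \<noteq> 0" using B(2) by (auto elim: oddE)
      then have "uB N B = u" using uB_punctured[OF B(1) NB _ B(3)] by simp
      then show ?thesis using Xplus_odd(1)[OF N X s] X CB cut by (simp add: XN_def)
    next
      case match
      then have "C \<in> Xminus N" using C by (auto simp: Xminus_iff)
      moreover have "cut N C = C" using match(1) unfolding cut_def by (simp only: if_False)
      ultimately show ?thesis by (simp add: close_up_def XN_def)
    next
      case free
      have cut: "cut N C = C" using free by (auto simp: cut_def)
      have NC: "N \<notin> supp C"
      proof
        assume "N \<in> supp C"
        then obtain X where X: "X \<in> C" "N \<in> X" by (auto simp: supp_def)
        then obtain k l where "X = {k, l}" by (metis PN_pairE[OF CP])
        then have "X = {k, N} \<or> X = {l, N}" using X(2) by auto
        then show False using X(1) free by blast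
      qed
      \<comment> \<open>Every \<open>B0\<close> arc passes over N, so if one existed, N would have
        to be matched.\<close>
      have "s0 C = 0"
      proof (rule ccontr)
        assume s: "s0 C \<noteq> 0"
        have "B0 C \<noteq> {}" using s by (auto simp: s0_def)
        then obtain k l where kl: "(k, l) \<in> B0 C" by auto
        then have a: "(k, l) \<in> arcs C" "l < k" by (auto simp: B0_iff_arcs)
        have "N \<in> cyc N k l" using a(2) arcs_range[OF CP a(1)] by (auto simp: cyc_def)
        moreover have "N \<notin> {k, l}" using NC a(1) by (auto simp: supp_def arcs_def)
        ultimately have "N \<in> cyc N k l - {k, l}" by blast
        then obtain k' l' where "(k', l') \<in> arcs C" "N \<in> {k', l'}" by (rule noncrE[OF C a(1)])
        then show False using NC by (auto simp: supp_def arcs_def)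
      qed
      then have "C \<in> Xplus N" using NC noncr_seq_ok(1)[OF C] by (simp add: Xplus_iff)
      then show ?thesis using cut \<open>s0 C = 0\<close> by (simp add: close_up_def XN_def)
    qed
  qed
  show "\<forall>C \<in> noncr N. close_up N (cut N C) = C" using key by blast
  show "cut N ` noncr N \<subseteq> XN N" using key by blast
qed

lemma symsum_insert:
  assumes "finite A" "a \<notin> A"
  shows "symsum f (insert a A) = sdiff (symsum f A) (f a)"
proof -
  have "odd (card {y \<in> insert a A. x \<in> f y}) \<longleftrightarrow> (odd (card {y \<in> A. x \<in> f y}) \<noteq> (x \<in> f a))" for x
  proof (cases "x \<in> f a")
    case True
    then have "{y \<in> insert a A. x \<in> f y} = insert a {y \<in> A. x \<in> f y}" by auto
    then show ?thesis using assms True by simp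
  next
    case False
    then have "{y \<in> insert a A. x \<in> f y} = {y \<in> A. x \<in> f y}" by auto
    then show ?thesis using False by simp
  qed
  then show ?thesis unfolding symsum_def sdiff_def by auto
qed

text \<open>The correction term is the bracket of the pair \<open>{uB N B, N}\<close>, so adding it
  amounts to summing over the enlarged matching.\<close>

lemma eps'_eq:
  assumes N: "odd N" and B: "B \<in> XN N"
  shows "eps' N B = symsum (brk N) (close_up N B)"
proof (cases "B \<in> Xminus N \<or> s0 B = 0")
  case True
  then show ?thesis by (simp add: eps'_def close_up_def Let_def)
next
  case False
  then have X: "B \<in> Xplus N" "s0 B \<noteq> 0" using B by (auto simp: XN_def)
  note p = Xplus_odd[OF N X]
  have "B \<in> PN N" "N \<notin> supp B" using X by (auto simp: Xplus_iff starPN_iff)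
  then have "finite B" "{uB N B, N} \<notin> B" using PN_finite by (auto simp: supp_def)
  then have S: "symsum (brk N) (close_up N B) = sdiff (symsum (brk N) B) (brk N {uB N B, N})"
    unfolding p(1) by (rule symsum_insert)
  show ?thesis
  proof (cases "even (uB N B)")
    case True
    then have "brk N {uB N B, N} = {uB N B..N}" using p(4) N by (simp add: brk_def)
    then show ?thesis using S False True by (simp add: eps'_def Let_def)
  next
    case odd: False
    then have "brk N {uB N B, N} = {N..N} \<union> {1..uB N B}" using p(4) N by (simp add: brk_def)
    \<comment> \<open>The two pieces are disjoint because \<open>uB N B < N\<close>, so their union
      may be added as two separate summands.\<close>
    moreover have "sdiff Y ({N..N} \<union> {1..uB N B}) = sdiff (sdiff Y {N..N}) {1..uB N B}" for Y
      using p(4) by (auto simp: sdiff_def)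
    ultimately show ?thesis using S False odd by (simp add: eps'_def Let_def)
  qed
qed

theorem theorem2p9:
  fixes N :: nat
  assumes "odd N" and "N \<ge> 3"
  shows "bij_betw (eps' N) (XN N) (EN N)"
proof -
  have "bij_betw (symsum (brk N) \<circ> close_up N) (XN N) (EN N)"
    using close_up_bij[OF assms(1)] noncr_symsum_bij[OF assms(1)] by (rule bij_betw_trans)
  then show ?thesis
    using eps'_eq[OF assms(1)] by (subst bij_betw_cong[where g = "symsum (brk N) \<circ> close_up N"]) auto
qed

end
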